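(* Let $K$ be an algebraically closed field, let $m\ge 1$ and $k\ge 0$ be integers, let $S=K[x_{i,j}^{(l)}\mid 1\le i,j\le m,\ 0\le l\le k]$, and let $I^{m,m}_{m,k}\subset S$ be the $k$-th jet ideal of the ideal generated by the determinant of the generic $m\times m$ matrix. Let $LM(I^{m,m}_{m,k})$ be its leading ideal with respect to the monomial order fixed in the context, let $R=S/LM(I^{m,m}_{m,k})$, and let $\Delta$ be the Stanley-Reisner abstract simplicial complex corresponding to $R$. Then $\Delta$ is shellable, and the Hilbert series of $R$ (in the variable $z$) is $$\frac{(1-z^{m})^{k+1}}{(1-z)^{m^{2}(k+1)}}.$$
   Context: Jet ideal: let $f=\det(x_{i,j})_{1\le i,j\le m}$. Substitute $x_{i,j}=x_{i,j}^{(0)}+x_{i,j}^{(1)}t+\dots+x_{i,j}^{(k)}t^{k}$ and write $f=f^{(0)}+f^{(1)}t+\dots+f^{(k)}t^{k} \pmod{t^{k+1}}$ with $f^{(l)}\in S$. Then $I^{m,m}_{m,k}=(f^{(0)},\dots,f^{(k)})$. Monomial order: order the variables by $x_{1,1}^{(k)}>\dots>x_{1,m}^{(k)}>\dots>x_{m,1}^{(k)}>\dots>x_{m,m}^{(k)}>x_{1,1}^{(k-1)}>\dots>x_{m,m}^{(k-1)}>\dots>x_{m,m}^{(0)}$ (higher upper index is larger; within the same upper index, row by row, left to right), and use the graded reverse lexicographic order: monomials are compared by total degree first, and in equal degree $x^\alpha>x^\beta$ iff the last nonzero entry of $\alpha-\beta$ (i.e. that of the smallest variable at which they differ) is negative.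 $LM(I)$ is the ideal generated by the leading monomials of all nonzero elements of $I$. It is a known fact that, under this order, $f^{(0)},\dots,f^{(k)}$ form a Gröbner basis of $I^{m,m}_{m,k}$, and that $LM(I^{m,m}_{m,k})$ is a squarefree (radical) monomial ideal. The Stanley-Reisner complex corresponding to $S/J$, for a squarefree monomial ideal $J$, is the simplicial complex on the set of variables of $S$ whose faces are the sets of variables whose product is not in $J$. Facets are the maximal faces under inclusion; the dimension of a facet $X$ is $|X|-1$. A simplicial complex is called shellable if all its facets have the same dimension and the facets can be arranged in a sequence $F_1,\dots,F_e$ such that for all $1\le i<j\le e$ there exist an element $v\in F_j\setminus F_i$ and an index $q<j$ with $F_j\setminus F_q=\{v\}$. The Hilbert series of $R$ is taken with respect to the standard grading in which every variable has degree $1$. *)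

theory Defs
  imports
    "HOL-Library.Poly_Mapping"
    "HOL-Algebra.QuotRing"
    "HOL-Algebra.Embedded_Algebras"
    "HOL-Computational_Algebra.Formal_Power_Series"
    "Jordan_Normal_Form.Determinant"
begin

section \<open>Polynomial rings in a given set of variables\<close>

text \<open>
  A monomial is its finitely supported exponent vector; a polynomial is the finitely supported
  map from monomials to coefficients.  Poly_Mapping equips the latter type with the convolution
  product.
\<close>

type_synonym 'v monomial = "'v \<Rightarrow>\<^sub>0 nat"
type_synonym ('v, 'k) mpoly = "'v monomial \<Rightarrow>\<^sub>0 'k"

definition Const :: "'k \<Rightarrow> ('v, 'k::zero) mpoly" where
  "Const c = Poly_Mapping.single 0 c"

definition mon :: "'v monomial \<Rightarrow> ('v, 'k::zero_neq_one) mpoly" where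
  "mon a = Poly_Mapping.single a 1"

definition X :: "'v \<Rightarrow> ('v, 'k::zero_neq_one) mpoly" where
  "X v = mon (Poly_Mapping.single v 1)"

definition mdeg :: "'v monomial \<Rightarrow> nat" where
  "mdeg a = (\<Sum>v\<in>Poly_Mapping.keys a. Poly_Mapping.lookup a v)"

definition homogeneous :: "nat \<Rightarrow> ('v, 'k::zero) mpoly \<Rightarrow> bool" where
  "homogeneous d p \<longleftrightarrow> (\<forall>a\<in>Poly_Mapping.keys p. mdeg a = d)"

definition poly_ring :: "'v set \<Rightarrow> ('v, 'k::comm_ring_1) mpoly ring" where
  "poly_ring V =
     \<lparr>carrier = {p. \<forall>a\<in>Poly_Mapping.keys p. Poly_Mapping.keys a \<subseteq> V},
      monoid.mult = (*), one = 1, zero = 0, add = (+)\<rparr>"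


section \<open>Leading ideals\<close>

text \<open>In this section, \<open>lt a b\<close> is a strict order on monomials, with \<open>b\<close> the larger one.\<close>

definition lead_mon ::
  "('v monomial \<Rightarrow> 'v monomial \<Rightarrow> bool) \<Rightarrow> ('v, 'k::zero) mpoly \<Rightarrow> 'v monomial" where
  "lead_mon lt p =
     (THE a. a \<in> Poly_Mapping.keys p \<and> (\<forall>b\<in>Poly_Mapping.keys p. b \<noteq> a \<longrightarrow> lt b a))"

definition lead_ideal ::
  "('v monomial \<Rightarrow> 'v monomial \<Rightarrow> bool) \<Rightarrow> 'v set \<Rightarrow> ('v, 'k::comm_ring_1) mpoly set
     \<Rightarrow> ('v, 'k) mpoly set" where
  "lead_ideal lt V I = Idl\<^bsub>poly_ring V\<^esub> ((\<lambda>p. mon (lead_mon lt p)) ` (I - {0}))"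

text \<open>
  The graded reverse lexicographic order for a given strict order on the variables: in equal
  degree, the larger monomial has the smaller exponent at the smallest variable where they differ.
\<close>

definition grevlex :: "('v \<Rightarrow> 'v \<Rightarrow> bool) \<Rightarrow> 'v monomial \<Rightarrow> 'v monomial \<Rightarrow> bool" where
  "grevlex vlt b a \<longleftrightarrow>
     mdeg b < mdeg a \<or>
     mdeg b = mdeg a \<and>
       (\<exists>v. Poly_Mapping.lookup a v < Poly_Mapping.lookup b v \<and>
            (\<forall>w. vlt w v \<longrightarrow> Poly_Mapping.lookup a w = Poly_Mapping.lookup b w))"


section \<open>Hilbert series of a quotient of a polynomial ring\<close>

text \<open>
  Inside \<open>poly_ring V Quot J\<close>: the degree \<open>d\<close> component consists of the classes of the homogeneous
  polynomials of degree \<open>d\<close> (\<open>J\<close> is meant to be a homogeneous ideal), and the ground field sits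
  in the quotient as the set of classes of constants.
\<close>

definition quot_component ::
  "'v set \<Rightarrow> ('v, 'k::comm_ring_1) mpoly set \<Rightarrow> nat \<Rightarrow> ('v, 'k) mpoly set set" where
  "quot_component V J d =
     (\<lambda>p. J +>\<^bsub>poly_ring V\<^esub> p) ` {p \<in> carrier (poly_ring V). homogeneous d p}"

definition quot_field ::
  "'v set \<Rightarrow> ('v, 'k::comm_ring_1) mpoly set \<Rightarrow> ('v, 'k) mpoly set set" where
  "quot_field V J = range (\<lambda>c. J +>\<^bsub>poly_ring V\<^esub> Const c)"

definition hilbert_series ::
  "'v set \<Rightarrow> ('v, 'k::field) mpoly set \<Rightarrow> rat fps" where
  "hilbert_series V J =
     Abs_fps (\<lambda>d. of_nat (ring.dim (poly_ring V Quot J) (quot_field V J) (quot_component V J d)))"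


section \<open>Simplicial complexes\<close>

definition stanley_reisner ::
  "'v set \<Rightarrow> ('v, 'k::comm_ring_1) mpoly set \<Rightarrow> 'v set set" where
  "stanley_reisner V J = {F. F \<subseteq> V \<and> (\<Prod>v\<in>F. X v) \<notin> J}"

definition facets :: "'v set set \<Rightarrow> 'v set set" where
  "facets \<Delta> = {F \<in> \<Delta>. \<forall>G\<in>\<Delta>. F \<subseteq> G \<longrightarrow> G = F}"

definition facet_dim :: "'v set \<Rightarrow> int" where
  "facet_dim F = int (card F) - 1"

definition shellable :: "'v set set \<Rightarrow> bool" where
  "shellable \<Delta> \<longleftrightarrow>
     (\<forall>F\<in>facets \<Delta>. \<forall>G\<in>facets \<Delta>. facet_dim F = facet_dim G) \<and>
     (\<exists>Fs. distinct Fs \<and> set Fs = facets \<Delta> \<and>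
        (\<forall>i j. i < j \<and> j < length Fs \<longrightarrow>
           (\<exists>v \<in> Fs ! j - Fs ! i. \<exists>q<j. Fs ! j - Fs ! q = {v})))"


section \<open>Jets of the generic determinant\<close>

text \<open>The triple \<open>(i, j, l)\<close> stands for the variable \<open>x\<^sub>i\<^sub>,\<^sub>j\<close> with upper index \<open>l\<close>.\<close>

type_synonym jvar = "nat \<times> nat \<times> nat"

definition jet_vars :: "nat \<Rightarrow> nat \<Rightarrow> jvar set" where
  "jet_vars m k = {1..m} \<times> {1..m} \<times> {0..k}"

definition jvar_less :: "jvar \<Rightarrow> jvar \<Rightarrow> bool" where
  "jvar_less = (\<lambda>(i, j, l) (i', j', l').
     l < l' \<or> l = l' \<and> (i > i' \<or> i = i' \<and> j > j'))"

text \<open>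
  The generic matrix after the substitution, as a matrix of polynomials in \<open>t\<close> with coefficients
  in the multivariate polynomials.  Matrix positions start at \<open>0\<close>, variable indices at \<open>1\<close>.
\<close>

definition jet_matrix :: "nat \<Rightarrow> nat \<Rightarrow> (jvar, 'k::comm_ring_1) mpoly poly mat" where
  "jet_matrix m k =
     mat m m (\<lambda>(i, j). \<Sum>l\<in>{0..k}. Polynomial.monom (X (Suc i, Suc j, l)) l)"

definition jet_det :: "nat \<Rightarrow> nat \<Rightarrow> nat \<Rightarrow> (jvar, 'k::comm_ring_1) mpoly" where
  "jet_det m k l = Polynomial.coeff (det (jet_matrix m k)) l"

definition jet_ideal :: "nat \<Rightarrow> nat \<Rightarrow> (jvar, 'k::comm_ring_1) mpoly set" where
  "jet_ideal m k = Idl\<^bsub>poly_ring (jet_vars m k)\<^esub> (jet_det m k ` {0..k})"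

definition jet_lead_ideal :: "nat \<Rightarrow> nat \<Rightarrow> (jvar, 'k::comm_ring_1) mpoly set" where
  "jet_lead_ideal m k = lead_ideal (grevlex jvar_less) (jet_vars m k) (jet_ideal m k)"

end

theory Submission
  imports Defs
begin

text \<open>
  In grevlex, the leading monomial of \<open>f\<^bsup>(l)\<^esup>\<close> is the product of the variables
  \<open>(i, j, a)\<close> with \<open>(a + 1) * m + 1 = l + i + j\<close>.  Hence the leading monomials of the generators are
  squarefree of degree \<open>m\<close> and have pairwise disjoint supports \<open>D\<^sub>0, \<dots>, D\<^sub>k\<close>.
  Generators with pairwise coprime leading monomials form a Groebner basis, so a squarefree monomial
  lies in the leading ideal iff its support contains some \<open>D\<^sub>l\<close>.  The complex is therefore the
  join of the boundaries of the simplices \<open>D\<^sub>l\<close> and a full simplex, which is shellable, and each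
  \<open>D\<^sub>l\<close> contributes a factor \<open>1 - z\<^sup>m\<close> to the Hilbert series.
\<close>


section \<open>Complexes with pairwise disjoint minimal nonfaces\<close>

text \<open>Origin of the leading monomials: every term of the \<open>l\<close>-th jet picks one
  entry per row, with upper indices summing to \<open>l\<close>. Grevlex punishes small variables,
  that is low upper indices, so the largest term spreads \<open>l\<close> over the rows as evenly as
  possible. Rows with the lower index come first, because later rows hold smaller variables; and
  going upwards from the last row at each level, each row takes the leftmost free column, which
  gives antidiagonals. With rows and columns counted from 0, row \<open>i\<close> takes upper index
  \<open>(l + i) div m\<close> and column \<open>m - 1 - (l + i) mod m\<close>. Quotient and
  remainder determine \<open>l + i\<close>, whence the disjoint supports. The Groebner property is
  obtained by linear algebra instead of S-polynomials: a triangular change of basis of the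
  polynomial ring, in which multiplication by a generator sends basis elements to basis
  elements.\<close>

text \<open>A face misses a vertex of every block, and omitting one chosen vertex per block already
  suffices. Restoring an omitted vertex completes its block, since by disjointness the other choices
  remove nothing from it.\<close>

lemma facets_avoiding:
  fixes D :: "'l \<Rightarrow> 'v set"
  assumes D: "\<And>l. l \<in> L \<Longrightarrow> D l \<subseteq> V" and disj: "disjoint_family_on D L"
  shows "facets {F. F \<subseteq> V \<and> (\<forall>l\<in>L. \<not> D l \<subseteq> F)} = (\<lambda>c. V - c ` L) ` PiE L D"
    (is "facets ?\<Delta> = ?R")
proof (intro equalityI subsetI)
  fix F assume F: "F \<in> facets ?\<Delta>"
  then have "\<forall>l\<in>L. \<exists>v. v \<in> D l - F" by (auto simp: facets_def)
  then obtain c0 where c0: "\<And>l. l \<in> L \<Longrightarrow> c0 l \<in> D l - F" by metis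
  define c where "c = restrict c0 L"
  have c: "\<And>l. l \<in> L \<Longrightarrow> c l \<in> D l - F" using c0 by (simp add: c_def)
  have "V - c ` L \<in> ?\<Delta>" using c by blast
  moreover have "F \<subseteq> V - c ` L" using F c by (auto simp: facets_def)
  ultimately have "F = V - c ` L" using F unfolding facets_def by blast
  moreover have "c \<in> PiE L D" using c by (auto simp: c_def)
  ultimately show "F \<in> ?R" by blast
next
  fix F assume "F \<in> ?R"
  then obtain c where c: "c \<in> PiE L D" and F: "F = V - c ` L" by blast
  have c_in: "c l \<in> D l" if "l \<in> L" for l using c that by auto
  have "F \<in> ?\<Delta>" unfolding F using c_in by blast
  moreover have "G = F" if G: "G \<in> ?\<Delta>" and FG: "F \<subseteq> G" for G
  proof (rule ccontr)
    assume "G \<noteq> F"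
    with G FG obtain v where v: "v \<in> G" "v \<in> V" "v \<notin> F" by blast
    with F obtain l where l: "l \<in> L" "v = c l" by blast
    have "w \<in> G" if w: "w \<in> D l" for w
    proof (cases "w = v")
      case False
      have "w \<noteq> c l'" if "l' \<in> L" for l'
        using False c_in[OF that] l w that disj by (cases "l' = l") (auto simp: disjoint_family_on_def)
      then have "w \<in> F" using F D[OF l(1)] w by auto
      then show ?thesis using FG by blast
    qed (use v in simp)
    then show False using G l(1) by blast
  qed
  ultimately show "F \<in> facets ?\<Delta>" by (auto simp: facets_def)
qed

lemma disjoint_choice_inj:
  assumes "c \<in> PiE L D" "disjoint_family_on D L"
  shows "inj_on c L"
  using assms by (auto simp: inj_on_def disjoint_family_on_def PiE_iff) (metis IntI empty_iff)

text \<open>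
  A facet omits exactly one vertex of each \<open>D l\<close>.  Any enumeration by increasing sum of the ranks
  of the omitted vertices is a shelling: lowering the choice in a single block gives an earlier facet.
\<close>

lemma shellable_avoiding:
  fixes D :: "'l \<Rightarrow> 'v set"
  assumes "finite V" "finite L" and D: "\<And>l. l \<in> L \<Longrightarrow> D l \<subseteq> V"
    and disj: "disjoint_family_on D L"
  shows "shellable {F. F \<subseteq> V \<and> (\<forall>l\<in>L. \<not> D l \<subseteq> F)}" (is "shellable ?\<Delta>")
proof -
  have fac: "facets ?\<Delta> = (\<lambda>c. V - c ` L) ` PiE L D"
    using D disj by (rule facets_avoiding)
  have cV: "c ` L \<subseteq> V" if "c \<in> PiE L D" for c using that D by (auto simp: PiE_iff)
  have "card F = card V - card L" if "F \<in> facets ?\<Delta>" for F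
    using that fac cV disjoint_choice_inj[OF _ disj] \<open>finite L\<close>
    by (auto simp: card_Diff_subset card_image)
  then have dims: "\<forall>F\<in>facets ?\<Delta>. \<forall>G\<in>facets ?\<Delta>. facet_dim F = facet_dim G"
    by (simp add: facet_dim_def)
  obtain r :: "'v \<Rightarrow> nat" where r: "inj_on r V"
    using finite_imp_inj_to_nat_seg[OF \<open>finite V\<close>] by blast
  define key where "key F = (\<Sum>v\<in>V - F. r v)" for F
  have key: "key (V - c ` L) = (\<Sum>l\<in>L. r (c l))" if "c \<in> PiE L D" for c
    using cV[OF that] disjoint_choice_inj[OF that disj]
    by (simp add: key_def double_diff sum.reindex)
  have "finite (facets ?\<Delta>)"
    by (rule finite_subset[of _ "Pow V"]) (use \<open>finite V\<close> in \<open>auto simp: facets_def\<close>)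
  then obtain xs where xs: "set xs = facets ?\<Delta>" "distinct xs" using finite_distinct_list by blast
  define Fs where "Fs = sort_key key xs"
  have Fs: "set Fs = facets ?\<Delta>" "distinct Fs" "sorted (map key Fs)"
    using xs by (simp_all add: Fs_def)
  have mono: "key (Fs ! i) \<le> key (Fs ! j)" if "i \<le> j" "j < length Fs" for i j
    using sorted_nth_mono[OF Fs(3)] that by simp
  have "\<exists>v\<in>Fs ! j - Fs ! i. \<exists>q<j. Fs ! j - Fs ! q = {v}" if ij: "i < j" "j < length Fs" for i j
  proof -
    obtain c d where c: "c \<in> PiE L D" "Fs ! i = V - c ` L" and d: "d \<in> PiE L D" "Fs ! j = V - d ` L"
      using nth_mem[of i Fs] nth_mem[of j Fs] ij unfolding Fs(1) fac by auto
    have ne: "Fs ! i \<noteq> Fs ! j" using Fs(2) ij by (simp add: nth_eq_iff_index_eq)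
    have c_in: "c l \<in> D l" "d l \<in> D l" if "l \<in> L" for l using c(1) d(1) that by auto
    \<comment> \<open>Otherwise \<open>d\<close> ranks at most \<open>c\<close> in each block, while
      sortedness bounds the sums the other way. All ranks then agree, and injectivity of
      \<open>r\<close> makes the two facets equal.\<close>
    have "\<exists>l\<in>L. r (c l) < r (d l)"
    proof (rule ccontr)
      assume "\<not> ?thesis"
      then have le: "r (d l) \<le> r (c l)" if "l \<in> L" for l using that by force
      have "(\<Sum>l\<in>L. r (c l)) \<le> (\<Sum>l\<in>L. r (d l))"
        using mono[of i j] ij c d key by simp
      then have "r (d l) = r (c l)" if "l \<in> L" for l
        using sum_mono_inv[of "\<lambda>l. r (d l)" L "\<lambda>l. r (c l)"] le that \<open>finite L\<close>
        by (meson le_antisym sum_mono)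
      then have "d l = c l" if "l \<in> L" for l
        using that r c_in[OF that] D[OF that] by (auto dest: inj_onD)
      then have "c ` L = d ` L" by auto
      then show False using ne c d by simp
    qed
    then obtain l where l: "l \<in> L" "r (c l) < r (d l)" by blast
    \<comment> \<open>Exchange in one block: the facet of \<open>e\<close> has a smaller key, hence
      an earlier position, and differs from the facet of \<open>d\<close> only in omitting
      \<open>c l\<close> instead of \<open>d l\<close>.\<close>
    define e where "e = d(l := c l)"
    have e: "e \<in> PiE L D" using d(1) c(1) l(1) by (auto simp: e_def PiE_iff extensional_def)
    have "key (V - e ` L) < key (V - d ` L)"
      unfolding key[OF e] key[OF d(1)]
      by (rule sum_strict_mono_ex1) (use l \<open>finite L\<close> in \<open>auto simp: e_def\<close>)
    moreover obtain q where q: "q < length Fs" "Fs ! q = V - e ` L"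
      using e Fs(1) unfolding fac by (metis imageI in_set_conv_nth)
    ultimately have "q < j" using mono[of j q] d(2) by (metis leD leI)
    \<comment> \<open>Ranks separate the two inside block \<open>l\<close>, disjointness in all
      other blocks.\<close>
    have other: "c l \<noteq> d l'" if "l' \<in> L" for l'
      using l(2) c_in(1)[OF l(1)] c_in(2)[OF that] disjoint_family_onD[OF disj l(1) that]
      by (metis IntI empty_iff nat_neq_iff)
    have "c l \<in> Fs ! j - Fs ! i"
      using other l c_in(1) D[OF l(1)] c(2) d(2) by auto
    moreover have "Fs ! j - Fs ! q = {c l}"
      unfolding q(2) d(2) using other l c_in(1) D[OF l(1)] by (auto simp: e_def split: if_splits)
    ultimately show ?thesis using \<open>q < j\<close> by blast
  qed
  then show ?thesis unfolding shellable_def using dims Fs(1,2) by blast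
qed


section \<open>Counting monomials\<close>

lemma mdeg_eq_sum:
  assumes "finite V" "Poly_Mapping.keys a \<subseteq> V"
  shows "mdeg a = (\<Sum>v\<in>V. Poly_Mapping.lookup a v)"
  unfolding mdeg_def using assms by (intro sum.mono_neutral_left) (auto simp: in_keys_iff)

lemma mdeg_add: "mdeg (a + b) = mdeg a + mdeg b"
proof -
  let ?V = "Poly_Mapping.keys a \<union> Poly_Mapping.keys b"
  have "mdeg (a + b) = (\<Sum>v\<in>?V. Poly_Mapping.lookup (a + b) v)"
    using keys_add[of a b] by (intro mdeg_eq_sum) auto
  also have "\<dots> = mdeg a + mdeg b"
    by (simp add: lookup_add sum.distrib mdeg_eq_sum[of ?V])
  finally show ?thesis .
qed

lemma mdeg_0 [simp]: "mdeg 0 = 0" by (simp add: mdeg_def)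

lemma mdeg_single [simp]: "mdeg (Poly_Mapping.single v n) = n" by (simp add: mdeg_def)

lemma mdeg_sum: "mdeg (sum f A) = (\<Sum>x\<in>A. mdeg (f x))"
  by (induction A rule: infinite_finite_induct) (auto simp: mdeg_add)

lemma keys_add_monomial:
  "Poly_Mapping.keys (a + b :: 'v monomial) = Poly_Mapping.keys a \<union> Poly_Mapping.keys b"
  by (auto simp: in_keys_iff lookup_add)

lemma finite_monomials_le:
  assumes "finite V"
  shows "finite {a :: 'v monomial. Poly_Mapping.keys a \<subseteq> V \<and> mdeg a \<le> d}" (is "finite ?A")
proof (rule finite_imageD)
  have "Poly_Mapping.lookup a v \<le> d" if "a \<in> ?A" "v \<in> V" for a v
    using that member_le_sum[of v V "Poly_Mapping.lookup a"] mdeg_eq_sum[of V a] \<open>finite V\<close> by simp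
  then have "Poly_Mapping.lookup ` ?A \<subseteq>
      {f. \<forall>v. (v \<in> V \<longrightarrow> f v \<in> {..d}) \<and> (v \<notin> V \<longrightarrow> f v = 0)}"
    by (auto simp: in_keys_iff)
  then show "finite (Poly_Mapping.lookup ` ?A)"
    by (rule finite_subset) (rule finite_set_of_finite_funs[OF \<open>finite V\<close> finite_atMost])
  show "inj_on Poly_Mapping.lookup ?A" by (auto simp: inj_on_def)
qed

section \<open>Squarefree monomials and series counting monomials by degree\<close>

definition sqfree_mon :: "'v set \<Rightarrow> 'v monomial" where
  "sqfree_mon D = (\<Sum>v\<in>D. Poly_Mapping.single v 1)"

lemma lookup_sqfree_mon:
  "finite D \<Longrightarrow> Poly_Mapping.lookup (sqfree_mon D) v = (if v \<in> D then 1 else 0)"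
  by (simp add: sqfree_mon_def lookup_sum lookup_single when_def)

lemma keys_sqfree_mon: "finite D \<Longrightarrow> Poly_Mapping.keys (sqfree_mon D) = D"
  by (auto simp: in_keys_iff lookup_sqfree_mon split: if_splits)

lemma mdeg_sqfree_mon: "mdeg (sqfree_mon D) = card D"
  by (simp add: sqfree_mon_def mdeg_sum)

text \<open>Subtraction of exponents is truncated; the inclusion of \<open>D\<close> in the support
  makes it exact.\<close>

lemma sqfree_mon_add_diff:
  assumes "finite D" "D \<subseteq> Poly_Mapping.keys a"
  shows "sqfree_mon D + (a - sqfree_mon D) = a"
proof (rule poly_mapping_eqI)
  fix v
  show "Poly_Mapping.lookup (sqfree_mon D + (a - sqfree_mon D)) v = Poly_Mapping.lookup a v"
    using assms by (cases "v \<in> D") (auto simp: lookup_add lookup_minus lookup_sqfree_mon in_keys_iff Suc_leI)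
qed

definition mono_series :: "'v monomial set \<Rightarrow> rat fps" where
  "mono_series A = Abs_fps (\<lambda>d. of_nat (card {a \<in> A. mdeg a = d}))"

text \<open>Multiplication by \<open>M\<close> is injective and shifts degrees by
  \<open>mdeg M\<close>. Both applications take \<open>C = A\<close>, so that the equation reads
  \<open>mono_series A * (1 - fps_X ^ mdeg M) = mono_series B\<close>.\<close>

lemma mono_series_split:
  assumes fin: "\<And>d. finite {a \<in> A. mdeg a = d}"
    and A: "A = B \<union> (+) M ` C" and disj: "B \<inter> (+) M ` C = {}"
  shows "mono_series A = mono_series B + fps_X ^ mdeg M * mono_series C"
proof (rule fps_ext)
  fix d
  have "{a \<in> A. mdeg a = d} = {a \<in> B. mdeg a = d} \<union> {a \<in> (+) M ` C. mdeg a = d}"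
    using A by blast
  then have "card {a \<in> A. mdeg a = d} = card {a \<in> B. mdeg a = d} + card {a \<in> (+) M ` C. mdeg a = d}"
    using disj fin[of d] by (subst card_Un_disjoint[symmetric]) auto
  moreover have "{a \<in> (+) M ` C. mdeg a = d} =
      (if d < mdeg M then {} else (+) M ` {a \<in> C. mdeg a = d - mdeg M})"
    by (auto simp: mdeg_add)
  ultimately show "fps_nth (mono_series A) d = fps_nth (mono_series B + fps_X ^ mdeg M * mono_series C) d"
    by (simp add: mono_series_def fps_X_power_mult_nth card_image)
qed

definition monomials_avoiding :: "'v set \<Rightarrow> ('l \<Rightarrow> 'v set) \<Rightarrow> 'l set \<Rightarrow> 'v monomial set" where
  "monomials_avoiding V D L =
     {a. Poly_Mapping.keys a \<subseteq> V \<and> (\<forall>l\<in>L. \<not> D l \<subseteq> Poly_Mapping.keys a)}"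

lemma finite_monomials_avoiding_deg:
  "finite V \<Longrightarrow> finite {a \<in> monomials_avoiding V D L. mdeg a = d}"
  by (rule finite_subset[OF _ finite_monomials_le[of V d]]) (auto simp: monomials_avoiding_def)

lemma mono_series_all_monomials:
  assumes "finite V"
  shows "mono_series (monomials_avoiding V D {}) * (1 - fps_X) ^ card V = 1"
  using assms
proof (induction V)
  case empty
  have "{a :: 'a monomial. a = 0 \<and> mdeg a = d} = (if d = 0 then {0} else {})" for d by auto
  then show ?case
    by (auto simp: mono_series_def monomials_avoiding_def fps_eq_iff)
next
  case (insert v V)
  let ?H = "\<lambda>V. mono_series (monomials_avoiding V D {})"
  let ?x = "sqfree_mon {v}"
  have "?H (insert v V) = ?H V + fps_X ^ mdeg ?x * ?H (insert v V)"
  proof (rule mono_series_split)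
    show "finite {a \<in> monomials_avoiding (insert v V) D {}. mdeg a = d}" for d
      using insert by (intro finite_monomials_avoiding_deg) auto
    have "a \<in> (+) ?x ` monomials_avoiding (insert v V) D {}"
      if a: "Poly_Mapping.keys a \<subseteq> insert v V" "\<not> Poly_Mapping.keys a \<subseteq> V" for a
    proof (rule image_eqI)
      show eq: "a = ?x + (a - ?x)" using a by (intro sqfree_mon_add_diff[symmetric]) auto
      then have "Poly_Mapping.keys (a - ?x) \<subseteq> Poly_Mapping.keys a" by (metis keys_add_monomial Un_upper2)
      then show "a - ?x \<in> monomials_avoiding (insert v V) D {}"
        using a by (simp add: monomials_avoiding_def)
    qed
    then show "monomials_avoiding (insert v V) D {} =
        monomials_avoiding V D {} \<union> (+) ?x ` monomials_avoiding (insert v V) D {}"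
      by (fastforce simp: monomials_avoiding_def keys_add_monomial keys_sqfree_mon)
    show "monomials_avoiding V D {} \<inter> (+) ?x ` monomials_avoiding (insert v V) D {} = {}"
      using insert.hyps by (auto simp: monomials_avoiding_def keys_add_monomial keys_sqfree_mon)
  qed
  then have "?H (insert v V) * (1 - fps_X) = ?H V"
    by (simp add: mdeg_sqfree_mon algebra_simps)
  then show ?case using insert by (simp add: mult.assoc[symmetric])
qed

text \<open>Because block \<open>l\<close> is disjoint from the others, multiplying by its monomial
  neither creates nor destroys a complete block among them. This is the combinatorial form of that
  monomial being a nonzerodivisor modulo the other generators, and it yields one factor per
  block.\<close>

lemma mono_series_monomials_avoiding:
  assumes "finite V" "finite L" and D: "\<And>l. l \<in> L \<Longrightarrow> D l \<subseteq> V" and disj: "disjoint_family_on D L"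
  shows "mono_series (monomials_avoiding V D L) =
    (\<Prod>l\<in>L. 1 - fps_X ^ card (D l)) * mono_series (monomials_avoiding V D {})"
  using assms(2) D disj
proof (induction L)
  case (insert l L)
  let ?S = "monomials_avoiding V D"
  let ?x = "sqfree_mon (D l)"
  have Dl: "D l \<subseteq> V" and fin: "finite (D l)" using insert.prems finite_subset[OF _ \<open>finite V\<close>] by auto
  have D_disj: "D l' \<inter> D l = {}" if "l' \<in> L" for l'
    using that insert.prems insert.hyps by (auto simp: disjoint_family_on_def)
  have D_iff: "D l' \<subseteq> D l \<union> K \<longleftrightarrow> D l' \<subseteq> K" if "l' \<in> L" for l' K
    using D_disj[OF that] by blast
  have "mono_series (?S L) = mono_series (?S (insert l L)) + fps_X ^ mdeg ?x * mono_series (?S L)"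
  proof (rule mono_series_split)
    show "finite {a \<in> ?S L. mdeg a = d}" for d
      using \<open>finite V\<close> by (rule finite_monomials_avoiding_deg)
    have "a \<in> (+) ?x ` ?S L" if a: "a \<in> ?S L" "D l \<subseteq> Poly_Mapping.keys a" for a
    proof (rule image_eqI)
      show eq: "a = ?x + (a - ?x)" using a fin by (intro sqfree_mon_add_diff[symmetric]) auto
      then have "Poly_Mapping.keys (a - ?x) \<subseteq> Poly_Mapping.keys a" by (metis keys_add_monomial Un_upper2)
      then show "a - ?x \<in> ?S L"
        using a unfolding monomials_avoiding_def by blast
    qed
    moreover have "?x + a \<in> ?S L" if "a \<in> ?S L" for a
      using that Dl fin by (auto simp: monomials_avoiding_def keys_add_monomial keys_sqfree_mon D_iff)
    moreover have "?S (insert l L) = {a \<in> ?S L. \<not> D l \<subseteq> Poly_Mapping.keys a}"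
      by (auto simp: monomials_avoiding_def)
    ultimately show "?S L = ?S (insert l L) \<union> (+) ?x ` ?S L" by blast
    show "?S (insert l L) \<inter> (+) ?x ` ?S L = {}"
      using fin by (auto simp: monomials_avoiding_def keys_add_monomial keys_sqfree_mon)
  qed
  then have "mono_series (?S (insert l L)) = (1 - fps_X ^ card (D l)) * mono_series (?S L)"
    by (simp add: mdeg_sqfree_mon algebra_simps)
  moreover have "disjoint_family_on D L"
    using insert.prems(2) by (auto simp: disjoint_family_on_def)
  ultimately show ?case using insert by (simp add: mult.assoc)
qed simp


section \<open>Ideals of polynomial rings\<close>

lemma poly_ring_simps [simp]:
  "monoid.mult (poly_ring V) = (*)" "one (poly_ring V) = 1"
  "zero (poly_ring V) = 0" "add (poly_ring V) = (+)"
  by (simp_all add: poly_ring_def)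

lemma in_poly_ring: "p \<in> carrier (poly_ring V) \<longleftrightarrow> (\<forall>a\<in>Poly_Mapping.keys p. Poly_Mapping.keys a \<subseteq> V)"
  by (simp add: poly_ring_def)

lemma keys_uminus [simp]: "Poly_Mapping.keys (- p :: 'a \<Rightarrow>\<^sub>0 'b::ab_group_add) = Poly_Mapping.keys p"
  by (auto simp: in_keys_iff)

lemma keys_sum_subset: "Poly_Mapping.keys (\<Sum>x\<in>A. f x) \<subseteq> (\<Union>x\<in>A. Poly_Mapping.keys (f x))"
  by (induction A rule: infinite_finite_induct) (use keys_add in \<open>fastforce+\<close>)

lemma keys_multE:
  assumes "c \<in> Poly_Mapping.keys (p * q)"
  obtains a b where "c = a + b" "a \<in> Poly_Mapping.keys p" "b \<in> Poly_Mapping.keys q"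
  using assms keys_mult[of p q] by blast

lemma poly_ring_closed:
  fixes p q :: "('v, 'k::comm_ring_1) mpoly"
  shows "(0 :: ('v, 'k) mpoly) \<in> carrier (poly_ring V)" "(1 :: ('v, 'k) mpoly) \<in> carrier (poly_ring V)"
  and "p \<in> carrier (poly_ring V) \<Longrightarrow> q \<in> carrier (poly_ring V) \<Longrightarrow> p + q \<in> carrier (poly_ring V)"
  and "p \<in> carrier (poly_ring V) \<Longrightarrow> q \<in> carrier (poly_ring V) \<Longrightarrow> p * q \<in> carrier (poly_ring V)"
  and "p \<in> carrier (poly_ring V) \<Longrightarrow> - p \<in> carrier (poly_ring V)"
  and "p \<in> carrier (poly_ring V) \<Longrightarrow> q \<in> carrier (poly_ring V) \<Longrightarrow> p - q \<in> carrier (poly_ring V)"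
proof -
  show add: "p + q \<in> carrier (poly_ring V)"
    if "p \<in> carrier (poly_ring V)" "q \<in> carrier (poly_ring V)" for p q :: "('v, 'k) mpoly"
    using that keys_add[of p q] unfolding in_poly_ring by blast
  show "p * q \<in> carrier (poly_ring V)"
    if p: "p \<in> carrier (poly_ring V)" and q: "q \<in> carrier (poly_ring V)"
    unfolding in_poly_ring
  proof
    fix c assume "c \<in> Poly_Mapping.keys (p * q)"
    then show "Poly_Mapping.keys c \<subseteq> V"
      by (rule keys_multE) (use p q in \<open>auto simp: in_poly_ring keys_add_monomial\<close>)
  qed
  show "p - q \<in> carrier (poly_ring V)"
    if "p \<in> carrier (poly_ring V)" "q \<in> carrier (poly_ring V)"
    using that add[of p "- q"] by (simp add: in_poly_ring)
qed (simp_all add: in_poly_ring)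

lemma poly_ring_sum_closed:
  "(\<And>x. x \<in> A \<Longrightarrow> f x \<in> carrier (poly_ring V)) \<Longrightarrow> sum f A \<in> carrier (poly_ring V)"
  by (induction A rule: infinite_finite_induct) (auto intro: poly_ring_closed)

lemma poly_ring_prod_closed:
  "(\<And>x. x \<in> A \<Longrightarrow> f x \<in> carrier (poly_ring V)) \<Longrightarrow> prod f A \<in> carrier (poly_ring V)"
  by (induction A rule: infinite_finite_induct) (auto intro: poly_ring_closed)

lemma poly_ring_power_closed:
  "p \<in> carrier (poly_ring V) \<Longrightarrow> p ^ n \<in> carrier (poly_ring V)"
  by (induction n) (auto intro: poly_ring_closed)

lemma poly_ring_single_closed:
  "Poly_Mapping.keys a \<subseteq> V \<Longrightarrow> Poly_Mapping.single a c \<in> carrier (poly_ring V)"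
  by (simp add: in_poly_ring)

lemma poly_ring_Const_closed: "Const c \<in> carrier (poly_ring V)"
  by (simp add: Const_def poly_ring_single_closed)

lemma cring_poly_ring: "cring (poly_ring V :: ('v, 'k::comm_ring_1) mpoly ring)"
proof (rule cringI)
  show "abelian_group (poly_ring V :: ('v, 'k) mpoly ring)"
  proof (rule abelian_groupI)
    fix p :: "('v, 'k) mpoly"
    assume "p \<in> carrier (poly_ring V)"
    then show "\<exists>q\<in>carrier (poly_ring V). q \<oplus>\<^bsub>poly_ring V\<^esub> p = \<zero>\<^bsub>poly_ring V\<^esub>"
      by (intro bexI[of _ "- p"]) (auto intro: poly_ring_closed)
  qed (auto intro: poly_ring_closed simp: algebra_simps)
  show "Group.comm_monoid (poly_ring V :: ('v, 'k) mpoly ring)"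
    by (rule comm_monoidI) (auto intro: poly_ring_closed simp: algebra_simps)
qed (auto simp: algebra_simps)

lemma poly_ring_a_minus:
  assumes "p \<in> carrier (poly_ring V)" "q \<in> carrier (poly_ring V)"
  shows "p \<ominus>\<^bsub>poly_ring V\<^esub> q = p - q"
proof -
  interpret cring "poly_ring V :: ('a, 'b) mpoly ring" by (rule cring_poly_ring)
  have "\<ominus>\<^bsub>poly_ring V\<^esub> q = - q"
    using assms(2) by (intro minus_equality) (auto intro: poly_ring_closed)
  then show ?thesis by (simp add: a_minus_def)
qed

lemma ideal_poly_ringI:
  fixes I :: "('v, 'k::comm_ring_1) mpoly set"
  assumes "I \<subseteq> carrier (poly_ring V)" "0 \<in> I"
    and "\<And>p q. p \<in> I \<Longrightarrow> q \<in> I \<Longrightarrow> p + q \<in> I"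
    and mult: "\<And>p q. p \<in> carrier (poly_ring V) \<Longrightarrow> q \<in> I \<Longrightarrow> p * q \<in> I"
  shows "ideal I (poly_ring V)"
proof (rule idealI)
  interpret cring "poly_ring V :: ('v, 'k) mpoly ring" by (rule cring_poly_ring)
  show "ring (poly_ring V :: ('v, 'k) mpoly ring)" by (rule ring_axioms)
  show "subgroup I (add_monoid (poly_ring V))"
  proof (rule add.subgroupI)
    fix p assume "p \<in> I"
    then have "\<ominus>\<^bsub>poly_ring V\<^esub> p = (-1) * p"
      using assms(1) by (intro minus_equality) (auto intro: poly_ring_closed)
    then show "\<ominus>\<^bsub>poly_ring V\<^esub> p \<in> I"
      using mult[of "-1" p] \<open>p \<in> I\<close> by (simp add: poly_ring_closed)
  qed (use assms in auto)
next
  show "x \<otimes>\<^bsub>poly_ring V\<^esub> a \<in> I" "a \<otimes>\<^bsub>poly_ring V\<^esub> x \<in> I"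
    if "a \<in> I" "x \<in> carrier (poly_ring V)" for a x
    using mult[OF that(2,1)] by (simp_all add: mult.commute)
qed

lemma poly_mapping_sum_single:
  "p = (\<Sum>a\<in>Poly_Mapping.keys p. Poly_Mapping.single a (Poly_Mapping.lookup p a))"
  by (rule poly_mapping_eqI) (auto simp: lookup_sum lookup_single when_def in_keys_iff)

text \<open>Membership in a monomial ideal is decided term by term. \<open>G\<close> may be
  infinite, as it is when it consists of all leading monomials of an ideal.\<close>

lemma Idl_monomials:
  fixes V :: "'v set"
  assumes G: "\<And>g. g \<in> G \<Longrightarrow> Poly_Mapping.keys g \<subseteq> V"
  shows "Idl\<^bsub>poly_ring V\<^esub> (mon ` G :: ('v, 'k::comm_ring_1) mpoly set) =
    {p \<in> carrier (poly_ring V). \<forall>a\<in>Poly_Mapping.keys p. \<exists>g\<in>G. \<exists>b. a = g + b}" (is "?I = ?J")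
proof -
  interpret cring "poly_ring V :: ('v, 'k) mpoly ring" by (rule cring_poly_ring)
  have sub: "(mon ` G :: ('v, 'k) mpoly set) \<subseteq> carrier (poly_ring V)"
    using G by (auto simp: mon_def poly_ring_single_closed)
  interpret I: ideal ?I "poly_ring V" using sub by (rule genideal_ideal)
  have "ideal ?J (poly_ring V)"
  proof (rule ideal_poly_ringI)
    fix p q assume "p \<in> ?J" "q \<in> ?J"
    then show "p + q \<in> ?J" using keys_add[of p q] by (fastforce intro: poly_ring_closed)
  next
    fix p q :: "('v, 'k) mpoly"
    assume p: "p \<in> carrier (poly_ring V)" and q: "q \<in> ?J"
    have "\<exists>g\<in>G. \<exists>b. a = g + b" if a: "a \<in> Poly_Mapping.keys (p * q)" for a
    proof -
      obtain x y where "a = x + y" "y \<in> Poly_Mapping.keys q" using a by (rule keys_multE)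
      moreover from this q obtain g b where "g \<in> G" "y = g + b" by blast
      ultimately show ?thesis by (metis add.left_commute)
    qed
    then show "p * q \<in> ?J" using p q by (auto intro: poly_ring_closed)
  qed (auto intro: poly_ring_closed)
  moreover have "mon ` G \<subseteq> ?J"
    using sub by (auto simp: mon_def split: if_splits) (metis add.right_neutral)
  ultimately have "?I \<subseteq> ?J" by (rule genideal_minimal)
  moreover have "p \<in> ?I" if p: "p \<in> ?J" for p
  proof -
    have terms: "Poly_Mapping.single a (Poly_Mapping.lookup p a) \<in> ?I" if a: "a \<in> Poly_Mapping.keys p" for a
    proof -
      obtain g b where g: "g \<in> G" "a = g + b" using p a by blast
      have "Poly_Mapping.keys a \<subseteq> V" using p a by (simp add: in_poly_ring)
      then have "Poly_Mapping.keys b \<subseteq> V" by (simp add: g(2) keys_add_monomial)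
      then have "Poly_Mapping.single b (Poly_Mapping.lookup p a) * mon g \<in> ?I"
        using I.I_l_closed[of "mon g" "Poly_Mapping.single b (Poly_Mapping.lookup p a)"]
          genideal_self[OF sub] g(1) by (auto simp: poly_ring_single_closed)
      then show ?thesis by (simp add: g(2) mon_def mult_single add.commute)
    qed
    \<comment> \<open>Generalised to subsets of the support, so that closure of the ideal under
      binary sums can be iterated.\<close>
    have "(\<Sum>a\<in>A. Poly_Mapping.single a (Poly_Mapping.lookup p a)) \<in> ?I"
      if "A \<subseteq> Poly_Mapping.keys p" for A
      using finite_subset[OF that finite_keys] that
    proof (induction A rule: finite_induct)
      case empty
      then show ?case using I.zero_closed by simp
    next
      case (insert a A)
      then show ?case using terms I.a_closed[of "Poly_Mapping.single a (Poly_Mapping.lookup p a)"] by simp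
    qed
    from this[OF order.refl] show ?thesis using poly_mapping_sum_single[of p] by simp
  qed
  ultimately show ?thesis by blast
qed


section \<open>Polynomials with pairwise coprime leading monomials\<close>

text \<open>
  \<open>c\<close> is the coefficient of \<open>p\<close> at \<open>a\<close>, possibly \<open>0\<close>; only for \<open>c \<noteq> 0\<close> is \<open>a\<close> the leading monomial.
\<close>

definition leading ::
  "('v monomial \<Rightarrow> 'v monomial \<Rightarrow> bool) \<Rightarrow> ('v, 'k::comm_ring_1) mpoly \<Rightarrow> 'v monomial \<Rightarrow> 'k \<Rightarrow> bool" where
  "leading lt p a c \<longleftrightarrow> (\<forall>b\<in>Poly_Mapping.keys (p - Poly_Mapping.single a c). lt b a)"

text \<open>Well-foundedness enters only later, in the form of \<open>finite_below\<close> in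
  \<open>coprime_leading\<close>.\<close>

locale monomial_order =
  fixes lt :: "'v monomial \<Rightarrow> 'v monomial \<Rightarrow> bool"
  assumes irrefl: "\<not> lt a a"
    and trans: "lt a b \<Longrightarrow> lt b c \<Longrightarrow> lt a c"
    and total: "a \<noteq> b \<Longrightarrow> lt a b \<or> lt b a"
    and add_mono: "lt a b \<Longrightarrow> lt (a + c) (b + c)"
begin

lemma leading_single: "leading lt (Poly_Mapping.single a c) a c"
  by (simp add: leading_def)

lemma leading_keys:
  assumes "leading lt p a c" "b \<in> Poly_Mapping.keys p"
  shows "b = a \<or> lt b a"
proof -
  have "b = a \<or> b \<in> Poly_Mapping.keys (p - Poly_Mapping.single a c)"
    using assms(2) by (auto simp: in_keys_iff lookup_minus lookup_single when_def)
  then show ?thesis using assms(1) by (auto simp: leading_def)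
qed

lemma leading_lookup:
  assumes "leading lt p a c"
  shows "Poly_Mapping.lookup p a = c"
proof -
  have "a \<notin> Poly_Mapping.keys (p - Poly_Mapping.single a c)"
    using assms irrefl by (auto simp: leading_def)
  then show ?thesis by (simp add: in_keys_iff lookup_minus)
qed

lemma leading_add_lower:
  assumes "leading lt p a c" "\<And>b. b \<in> Poly_Mapping.keys q \<Longrightarrow> lt b a"
  shows "leading lt (p + q) a c"
proof -
  have eq: "p + q - Poly_Mapping.single a c = (p - Poly_Mapping.single a c) + q" by simp
  show ?thesis
    unfolding leading_def eq
  proof
    fix b assume "b \<in> Poly_Mapping.keys (p - Poly_Mapping.single a c + q)"
    then have "b \<in> Poly_Mapping.keys (p - Poly_Mapping.single a c) \<or> b \<in> Poly_Mapping.keys q"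
      using keys_add[of "p - Poly_Mapping.single a c" q] by blast
    then show "lt b a" using assms by (auto simp: leading_def)
  qed
qed

text \<open>Splitting off both top terms leaves only products below \<open>a + b\<close>. Since
  \<open>leading\<close> tolerates a zero coefficient, zero divisors do no harm.\<close>

lemma leading_mult:
  assumes p: "leading lt p a c" and q: "leading lt q b d"
  shows "leading lt (p * q) (a + b) (c * d)"
proof -
  define p' q' where "p' = p - Poly_Mapping.single a c" and "q' = q - Poly_Mapping.single b d"
  have eq: "p = Poly_Mapping.single a c + p'" "q = Poly_Mapping.single b d + q'"
    by (simp_all add: p'_def q'_def)
  have eq_mult: "p * q = Poly_Mapping.single (a + b) (c * d) + (Poly_Mapping.single a c * q' + p' * q)"
    unfolding eq by (simp add: algebra_simps mult_single)
  have lower1: "lt x (a + b)" if x: "x \<in> Poly_Mapping.keys (Poly_Mapping.single a c * q')" for x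
  proof -
    obtain y where "x = a + y" "y \<in> Poly_Mapping.keys q'"
      using x by (auto elim!: keys_multE split: if_splits)
    then show ?thesis using q add_mono[of y b a] by (simp add: leading_def q'_def add.commute)
  qed
  have lower2: "lt x (a + b)" if x: "x \<in> Poly_Mapping.keys (p' * q)" for x
  proof -
    obtain y z where yz: "x = y + z" "y \<in> Poly_Mapping.keys p'" "z \<in> Poly_Mapping.keys q"
      using x by (rule keys_multE)
    have "lt (y + z) (a + z)" using p yz(2) add_mono by (simp add: leading_def p'_def)
    moreover have "z = b \<or> lt (a + z) (a + b)"
      using leading_keys[OF q yz(3)] add_mono[of z b a] by (auto simp: add.commute)
    ultimately show ?thesis using trans yz(1) by blast
  qed
  show ?thesis
    unfolding eq_mult
  proof (rule leading_add_lower[OF leading_single])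
    fix x assume "x \<in> Poly_Mapping.keys (Poly_Mapping.single a c * q' + p' * q)"
    then show "lt x (a + b)"
      using lower1 lower2 keys_add[of "Poly_Mapping.single a c * q'" "p' * q"] by blast
  qed
qed

lemma leading_prod:
  assumes "\<And>x. x \<in> A \<Longrightarrow> leading lt (p x) (a x) (c x)"
  shows "leading lt (prod p A) (sum a A) (prod c A)"
proof (cases "finite A")
  case True
  then show ?thesis using assms
  proof (induction A)
    case empty
    then show ?case using leading_single[of 0 1] by simp
  next
    case (insert x A)
    then show ?case by (simp add: leading_mult)
  qed
next
  case False
  then show ?thesis using leading_single[of 0 1] by simp
qed

lemma leading_imp_lead_mon:
  assumes "leading lt p a c" "c \<noteq> 0"
  shows "lead_mon lt p = a" "p \<noteq> 0"
proof -
  have a: "a \<in> Poly_Mapping.keys p" using leading_lookup[OF assms(1)] assms(2) by (simp add: in_keys_iff)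
  then show "p \<noteq> 0" by auto
  show "lead_mon lt p = a"
    unfolding lead_mon_def
  proof (rule the_equality)
    show "a \<in> Poly_Mapping.keys p \<and> (\<forall>b\<in>Poly_Mapping.keys p. b \<noteq> a \<longrightarrow> lt b a)"
      using a leading_keys[OF assms(1)] by blast
    fix a' assume a': "a' \<in> Poly_Mapping.keys p \<and> (\<forall>b\<in>Poly_Mapping.keys p. b \<noteq> a' \<longrightarrow> lt b a')"
    then show "a' = a" using a leading_keys[OF assms(1), of a'] trans[of a a' a] irrefl[of a] by metis
  qed
qed

lemma finite_has_max:
  assumes "finite A" "A \<noteq> {}"
  obtains m where "m \<in> A" "\<And>a. a \<in> A \<Longrightarrow> a \<noteq> m \<Longrightarrow> lt a m"
proof -
  have "transp_on A lt" by (rule transp_onI) (rule trans)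
  moreover have "totalp_on A lt" by (rule totalp_onI) (rule total)
  ultimately have "\<exists>m\<in>A. \<forall>a\<in>A. a \<noteq> m \<longrightarrow> lt a m"
    by (rule Finite_Set.bex_greatest_element[OF assms])
  then show ?thesis using that by blast
qed

end

text \<open>Supplies \<open>mpoly.span\<close>, which is the span over the field and not over the
  polynomial ring.\<close>

interpretation mpoly: vector_space "\<lambda>(c :: 'k::field) (p :: ('v, 'k) mpoly). Const c * p"
proof
  fix x y :: 'k and p q :: "('v, 'k) mpoly"
  show "Const x * (p + q) = Const x * p + Const x * q" by (simp add: algebra_simps)
  show "Const (x + y) * p = Const x * p + Const y * p" by (simp add: Const_def single_add algebra_simps)
  show "Const x * (Const y * p) = Const (x * y) * p"
    by (simp add: Const_def mult_single mult.assoc[symmetric])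
  show "Const 1 * p = p" by (simp add: Const_def)
qed

context monomial_order
begin

lemma leading_power:
  "leading lt p a c \<Longrightarrow> leading lt (p ^ n) (\<Sum>i<n. a) (c ^ n)"
  using leading_prod[of "{..<n}" "\<lambda>_. p" "\<lambda>_. a" "\<lambda>_. c"] by simp

text \<open>The family is indexed by its own leading monomials, so these are distinct and the
  largest one cannot cancel.\<close>

lemma leading_sum:
  fixes B :: "'v monomial \<Rightarrow> ('v, 'k::idom) mpoly"
  assumes "finite F" "F \<noteq> {}" and B: "\<And>a. a \<in> F \<Longrightarrow> leading lt (B a) a (w a)"
    and nz: "\<And>a. a \<in> F \<Longrightarrow> w a \<noteq> 0 \<and> c a \<noteq> 0"
  obtains a d where "a \<in> F" "leading lt (\<Sum>a\<in>F. Const (c a) * B a) a d" "d \<noteq> 0"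
proof -
  obtain m where m: "m \<in> F" "\<And>a. a \<in> F \<Longrightarrow> a \<noteq> m \<Longrightarrow> lt a m"
    using finite_has_max assms(1,2) by blast
  have lead: "leading lt (Const (c a) * B a) a (c a * w a)" if "a \<in> F" for a
    using leading_mult[OF leading_single[of 0 "c a"] B[OF that]] by (simp add: Const_def)
  have "leading lt (Const (c m) * B m + (\<Sum>a\<in>F - {m}. Const (c a) * B a)) m (c m * w m)"
  proof (rule leading_add_lower[OF lead[OF m(1)]])
    fix b assume "b \<in> Poly_Mapping.keys (\<Sum>a\<in>F - {m}. Const (c a) * B a)"
    then obtain a where a: "a \<in> F" "a \<noteq> m" "b \<in> Poly_Mapping.keys (Const (c a) * B a)"
      using keys_sum_subset by fast
    show "lt b m" using leading_keys[OF lead[OF a(1)] a(3)] m(2)[OF a(1,2)] trans by blast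
  qed
  then have "leading lt (\<Sum>a\<in>F. Const (c a) * B a) m (c m * w m)"
    using m(1) assms(1) by (simp add: sum.remove)
  then show ?thesis using that m(1) nz by simp
qed

end

text \<open>
  Since the \<open>D l\<close> are disjoint, every monomial is uniquely a product of powers of the leading
  monomials of the \<open>f l\<close> and a monomial divisible by none of them.  Replacing the leading monomials
  by the \<open>f l\<close> themselves turns the monomials into a basis adapted to the ideal of the \<open>f l\<close>.
\<close>

locale coprime_leading = monomial_order lt
  for lt :: "'v monomial \<Rightarrow> 'v monomial \<Rightarrow> bool" +
  fixes V :: "'v set" and L :: "'l set" and D :: "'l \<Rightarrow> 'v set"
    and f :: "'l \<Rightarrow> ('v, 'k::field) mpoly" and u :: "'l \<Rightarrow> 'k"
  assumes finite_below: "Poly_Mapping.keys a \<subseteq> V \<Longrightarrow> finite {b. Poly_Mapping.keys b \<subseteq> V \<and> lt b a}"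
    and finite_V: "finite V" and finite_L: "finite L"
    and D_subset: "l \<in> L \<Longrightarrow> D l \<subseteq> V" and D_nonempty: "l \<in> L \<Longrightarrow> D l \<noteq> {}"
    and D_disjoint: "disjoint_family_on D L"
    and f_closed: "l \<in> L \<Longrightarrow> f l \<in> carrier (poly_ring V)"
    and f_leading: "l \<in> L \<Longrightarrow> leading lt (f l) (sqfree_mon (D l)) (u l)"
    and u_nonzero: "l \<in> L \<Longrightarrow> u l \<noteq> 0"
begin

section \<open>A basis adapted to the ideal\<close>

lemma finite_D: "l \<in> L \<Longrightarrow> finite (D l)"
  using D_subset finite_V finite_subset by blast

text \<open>For \<open>l\<close> in \<open>L\<close>, the largest power of
  \<open>sqfree_mon (D l)\<close> that divides \<open>a\<close>; blocks are finite and nonempty, so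
  \<open>Min\<close> is meaningful.\<close>

definition expo :: "'l \<Rightarrow> 'v monomial \<Rightarrow> nat" where
  "expo l a = Min (Poly_Mapping.lookup a ` D l)"

definition lead_part :: "'v monomial \<Rightarrow> 'v monomial" where
  "lead_part a = (\<Sum>l\<in>L. \<Sum>i<expo l a. sqfree_mon (D l))"

definition basis :: "'v monomial \<Rightarrow> ('v, 'k) mpoly" where
  "basis a = Poly_Mapping.single (a - lead_part a) 1 * (\<Prod>l\<in>L. f l ^ expo l a)"

lemma expo_add:
  assumes "l \<in> L" "j \<in> L"
  shows "expo l (sqfree_mon (D j) + a) = (if l = j then Suc (expo l a) else expo l a)"
proof (cases "l = j")
  case True
  have "expo l (sqfree_mon (D j) + a) = Min ((\<lambda>v. Poly_Mapping.lookup a v + 1) ` D l)"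
    unfolding expo_def using True assms finite_D
    by (intro arg_cong[where f = Min] image_cong) (auto simp: lookup_add lookup_sqfree_mon)
  then show ?thesis
    using True Min_add_commute[OF finite_D D_nonempty, of l "Poly_Mapping.lookup a" 1] assms
    by (simp add: expo_def)
next
  case False
  have "Poly_Mapping.lookup (sqfree_mon (D j) + a) v = Poly_Mapping.lookup a v" if "v \<in> D l" for v
    using that False assms D_disjoint finite_D
    by (auto simp: lookup_add lookup_sqfree_mon disjoint_family_on_def)
  then show ?thesis using False by (auto simp: expo_def cong: image_cong)
qed

lemma lead_part_add:
  assumes "j \<in> L"
  shows "lead_part (sqfree_mon (D j) + a) = sqfree_mon (D j) + lead_part a"
proof -
  have "(\<Sum>i<expo l (sqfree_mon (D j) + a). sqfree_mon (D l)) =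
      (if l = j then sqfree_mon (D j) else 0) + (\<Sum>i<expo l a. sqfree_mon (D l))" if "l \<in> L" for l
    using that assms by (simp add: expo_add lessThan_Suc)
  then show ?thesis
    using assms finite_L by (simp add: lead_part_def sum.distrib)
qed

text \<open>At most one block contains \<open>v\<close>, so at most one summand contributes. The
  bound makes the truncated difference in \<open>basis\<close> exact.\<close>

lemma lookup_lead_part_le: "Poly_Mapping.lookup (lead_part a) v \<le> Poly_Mapping.lookup a v"
proof -
  have eq: "Poly_Mapping.lookup (lead_part a) v = (\<Sum>l\<in>L. if v \<in> D l then expo l a else 0)"
    unfolding lead_part_def lookup_sum
    by (intro sum.cong) (auto simp: lookup_sum lookup_sqfree_mon finite_D)
  show ?thesis
  proof (cases "\<exists>l\<in>L. v \<in> D l")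
    case True
    then obtain l where l: "l \<in> L" "v \<in> D l" by blast
    have "v \<notin> D j" if "j \<in> L" "j \<noteq> l" for j
      using that l disjoint_family_onD[OF D_disjoint, of j l] by blast
    then have "(\<Sum>j\<in>L. if v \<in> D j then expo j a else 0) = (\<Sum>j\<in>L. if j = l then expo l a else 0)"
      using l by (intro sum.cong) auto
    also have "\<dots> = expo l a" using l finite_L by simp
    also have "\<dots> \<le> Poly_Mapping.lookup a v" unfolding expo_def using l finite_D by (intro Min_le) auto
    finally show ?thesis using eq by simp
  next
    case False
    then have "(\<Sum>l\<in>L. if v \<in> D l then expo l a else 0) = 0" by (intro sum.neutral) auto
    then show ?thesis using eq by simp
  qed
qed

lemma lead_part_decomp: "(a - lead_part a) + lead_part a = a"
  by (rule poly_mapping_eqI) (simp add: lookup_add lookup_minus lookup_lead_part_le)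

lemma basis_leading: "leading lt (basis a) a (\<Prod>l\<in>L. u l ^ expo l a)"
proof -
  have "leading lt (\<Prod>l\<in>L. f l ^ expo l a) (lead_part a) (\<Prod>l\<in>L. u l ^ expo l a)"
    unfolding lead_part_def by (intro leading_prod leading_power f_leading)
  from leading_mult[OF leading_single this, of "a - lead_part a" 1] show ?thesis
    by (simp add: basis_def lead_part_decomp)
qed

lemma basis_coeff_nonzero: "(\<Prod>l\<in>L. u l ^ expo l a) \<noteq> 0"
  using finite_L u_nonzero by simp

lemma basis_closed:
  assumes "Poly_Mapping.keys a \<subseteq> V"
  shows "basis a \<in> carrier (poly_ring V)"
  unfolding basis_def
proof (intro poly_ring_closed poly_ring_single_closed poly_ring_prod_closed poly_ring_power_closed f_closed)
  show "Poly_Mapping.keys (a - lead_part a) \<subseteq> V"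
    using assms keys_add_monomial[of "a - lead_part a" "lead_part a"] by (simp add: lead_part_decomp)
qed

text \<open>The reason for this choice of \<open>basis\<close>: multiplication by a generator acts
  on the index alone, so ideal membership becomes a condition on indices.\<close>

lemma basis_add:
  assumes "j \<in> L"
  shows "basis (sqfree_mon (D j) + a) = f j * basis a"
proof -
  have "(\<Prod>l\<in>L. f l ^ expo l (sqfree_mon (D j) + a)) =
      (\<Prod>l\<in>L. (if l = j then f j else 1) * f l ^ expo l a)"
    using assms by (intro prod.cong) (auto simp: expo_add)
  also have "\<dots> = f j * (\<Prod>l\<in>L. f l ^ expo l a)"
    using assms finite_L by (simp add: prod.distrib)
  finally show ?thesis by (simp add: basis_def lead_part_add[OF assms] mult.left_commute)
qed

definition nonstandard :: "'v monomial set" where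
  "nonstandard = {a. Poly_Mapping.keys a \<subseteq> V \<and> (\<exists>l\<in>L. D l \<subseteq> Poly_Mapping.keys a)}"

text \<open>Triangularity: \<open>basis a\<close> is a nonzero multiple of the monomial
  \<open>a\<close> plus smaller terms. The descent runs on the number of smaller monomials, finite
  by \<open>finite_below\<close>.\<close>

lemma single_in_span:
  assumes "Poly_Mapping.keys a \<subseteq> V"
  shows "Poly_Mapping.single a c \<in> mpoly.span (basis ` {b. Poly_Mapping.keys b \<subseteq> V})"
  using assms
proof (induction "card {b. Poly_Mapping.keys b \<subseteq> V \<and> lt b a}" arbitrary: a c rule: less_induct)
  case less
  let ?S = "mpoly.span (basis ` {b. Poly_Mapping.keys b \<subseteq> V})"
  let ?w = "\<Prod>l\<in>L. u l ^ expo l a"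
  define q where "q = basis a - Poly_Mapping.single a ?w"
  have lower: "lt b a" if "b \<in> Poly_Mapping.keys q" for b
    using that basis_leading by (simp add: q_def leading_def)
  have "q \<in> carrier (poly_ring V)"
    unfolding q_def using less.prems by (intro poly_ring_closed basis_closed poly_ring_single_closed)
  have IH: "Poly_Mapping.single b d \<in> ?S" if b: "b \<in> Poly_Mapping.keys q" for b d
  proof (rule less.hyps)
    show bV: "Poly_Mapping.keys b \<subseteq> V" using \<open>q \<in> _\<close> b by (simp add: in_poly_ring)
    show "card {c. Poly_Mapping.keys c \<subseteq> V \<and> lt c b} < card {c. Poly_Mapping.keys c \<subseteq> V \<and> lt c a}"
      by (rule psubset_card_mono[OF finite_below[OF less.prems]])
        (use bV lower[OF b] trans irrefl in blast)
  qed
  have "q \<in> ?S"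
    by (subst poly_mapping_sum_single) (intro mpoly.span_sum IH)
  moreover have "basis a \<in> ?S" using less.prems by (intro mpoly.span_base) simp
  ultimately have "Const (c / ?w) * (basis a - q) \<in> ?S"
    by (intro mpoly.span_scale mpoly.span_diff)
  then show ?case using basis_coeff_nonzero[of a] by (simp add: q_def Const_def mult_single)
qed

lemma poly_ring_subset_span: "carrier (poly_ring V) \<subseteq> mpoly.span (basis ` {b. Poly_Mapping.keys b \<subseteq> V})"
proof
  fix p :: "('v, 'k) mpoly" assume "p \<in> carrier (poly_ring V)"
  then show "p \<in> mpoly.span (basis ` {b. Poly_Mapping.keys b \<subseteq> V})"
    by (subst poly_mapping_sum_single) (intro mpoly.span_sum single_in_span, simp add: in_poly_ring)
qed

lemma f_mult_in_span:
  assumes "l \<in> L" "q \<in> carrier (poly_ring V)"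
  shows "f l * q \<in> mpoly.span (basis ` nonstandard)"
proof -
  have "q \<in> mpoly.span (basis ` {b. Poly_Mapping.keys b \<subseteq> V})"
    using poly_ring_subset_span assms(2) by blast
  then show ?thesis
  proof (induction rule: mpoly.span_induct_alt)
    case base
    then show ?case by (simp add: mpoly.span_zero)
  next
    case (step c x y)
    then obtain b where b: "Poly_Mapping.keys b \<subseteq> V" "x = basis b" by blast
    have "sqfree_mon (D l) + b \<in> nonstandard"
      using b(1) D_subset assms(1) finite_D
      by (auto simp: nonstandard_def keys_add_monomial keys_sqfree_mon)
    then have "f l * x \<in> mpoly.span (basis ` nonstandard)"
      unfolding b(2) basis_add[OF assms(1), symmetric] by (intro mpoly.span_base) simp
    then have "Const c * (f l * x) + f l * y \<in> mpoly.span (basis ` nonstandard)"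
      using step by (intro mpoly.span_add mpoly.span_scale)
    then show ?case by (simp add: algebra_simps)
  qed
qed

text \<open>Every nonstandard basis element has some \<open>f l\<close> as a factor, so the product
  is \<open>f l\<close> times another polynomial of the ring and \<open>f_mult_in_span\<close>
  applies.\<close>

lemma mult_in_span:
  assumes "p \<in> carrier (poly_ring V)" "q \<in> mpoly.span (basis ` nonstandard)"
  shows "p * q \<in> mpoly.span (basis ` nonstandard)"
  using assms(2)
proof (induction rule: mpoly.span_induct_alt)
  case base
  then show ?case by (simp add: mpoly.span_zero)
next
  case (step c x y)
  then obtain a l where a: "x = basis a" "Poly_Mapping.keys a \<subseteq> V" "l \<in> L" "D l \<subseteq> Poly_Mapping.keys a"
    by (auto simp: nonstandard_def)
  define b where "b = a - sqfree_mon (D l)"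
  have eq: "a = sqfree_mon (D l) + b"
    unfolding b_def using a finite_D by (simp add: sqfree_mon_add_diff)
  have "Poly_Mapping.keys b \<subseteq> V" using a(2) unfolding eq keys_add_monomial by simp
  then have "f l * (p * basis b) \<in> mpoly.span (basis ` nonstandard)"
    using a(3) assms(1) by (intro f_mult_in_span poly_ring_closed basis_closed)
  then have "p * x \<in> mpoly.span (basis ` nonstandard)"
    by (simp add: a(1) eq basis_add[OF a(3)] mult.left_commute)
  then have "Const c * (p * x) + p * y \<in> mpoly.span (basis ` nonstandard)"
    using step by (intro mpoly.span_add mpoly.span_scale)
  then show ?case by (simp add: algebra_simps)
qed

lemma Idl_subset_span:
  "Idl\<^bsub>poly_ring V\<^esub> (f ` L) \<subseteq> carrier (poly_ring V) \<inter> mpoly.span (basis ` nonstandard)"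
proof -
  interpret cring "poly_ring V :: ('v, 'k) mpoly ring" by (rule cring_poly_ring)
  show ?thesis
  proof (rule genideal_minimal)
    show "ideal (carrier (poly_ring V) \<inter> mpoly.span (basis ` nonstandard)) (poly_ring V)"
      by (rule ideal_poly_ringI)
        (auto intro: poly_ring_closed mpoly.span_zero mpoly.span_add mult_in_span)
    show "f ` L \<subseteq> carrier (poly_ring V) \<inter> mpoly.span (basis ` nonstandard)"
      using f_closed f_mult_in_span[of _ 1] by (auto intro: poly_ring_closed)
  qed
qed

lemma span_leading:
  assumes "p \<in> mpoly.span (basis ` nonstandard)" "p \<noteq> 0"
  obtains a c where "a \<in> nonstandard" "leading lt p a c" "c \<noteq> 0"
proof -
  obtain t r where t: "finite t" "t \<subseteq> basis ` nonstandard" "p = (\<Sum>x\<in>t. Const (r x) * x)"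
    using assms(1) unfolding mpoly.span_explicit by blast
  \<comment> \<open>One index per basis element, turning the combination into a sum over monomials
    as \<open>leading_sum\<close> requires; zero coefficients are dropped next.\<close>
  obtain F where F: "F \<subseteq> nonstandard" "inj_on basis F" "t = basis ` F"
    using t(2) by (auto simp: subset_image_inj)
  have finF: "finite F" using t(1) F by (auto dest: finite_imageD)
  define F' where "F' = {a \<in> F. r (basis a) \<noteq> 0}"
  have "p = (\<Sum>a\<in>F. Const (r (basis a)) * basis a)" using t(3) F by (simp add: sum.reindex)
  also have "\<dots> = (\<Sum>a\<in>F'. Const (r (basis a)) * basis a)"
    using finF by (intro sum.mono_neutral_right) (auto simp: F'_def Const_def)
  finally have p: "p = (\<Sum>a\<in>F'. Const (r (basis a)) * basis a)" .
  have "finite F'" using finF by (simp add: F'_def)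
  moreover have "F' \<noteq> {}" using p assms(2) by (metis sum.empty)
  ultimately obtain a c where "a \<in> F'" "leading lt p a c" "c \<noteq> 0"
    using leading_sum[of F' basis "\<lambda>a. \<Prod>l\<in>L. u l ^ expo l a" "\<lambda>a. r (basis a)"]
      basis_leading basis_coeff_nonzero unfolding p F'_def by blast
  then show ?thesis using that F(1) by (auto simp: F'_def)
qed

text \<open>Leading monomials of the ideal are nonstandard because the ideal lies in the span of the
  nonstandard basis elements; conversely each \<open>sqfree_mon (D l)\<close> is the leading
  monomial of \<open>f l\<close>.\<close>

theorem lead_ideal_eq:
  "lead_ideal lt V (Idl\<^bsub>poly_ring V\<^esub> (f ` L)) =
    {p \<in> carrier (poly_ring V). \<forall>a\<in>Poly_Mapping.keys p. \<exists>l\<in>L. D l \<subseteq> Poly_Mapping.keys a}"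
proof -
  interpret cring "poly_ring V :: ('v, 'k) mpoly ring" by (rule cring_poly_ring)
  let ?I = "Idl\<^bsub>poly_ring V\<^esub> (f ` L)"
  define G where "G = lead_mon lt ` (?I - {0})"
  have G: "g \<in> nonstandard" if g: "g \<in> G" for g
  proof -
    obtain p where p: "p \<in> ?I" "p \<noteq> 0" "g = lead_mon lt p" using g by (auto simp: G_def)
    obtain a c where "a \<in> nonstandard" "leading lt p a c" "c \<noteq> 0"
      using span_leading p Idl_subset_span by blast
    then show ?thesis using leading_imp_lead_mon(1) p(3) by metis
  qed
  have sub: "f ` L \<subseteq> carrier (poly_ring V)" using f_closed by blast
  have D_in_G: "sqfree_mon (D l) \<in> G" if "l \<in> L" for l
    using leading_imp_lead_mon[OF f_leading u_nonzero, OF that that] genideal_self[OF sub] that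
    unfolding G_def by (intro image_eqI[of _ _ "f l"]) auto
  have "(\<exists>g\<in>G. \<exists>b. a = g + b) \<longleftrightarrow> (\<exists>l\<in>L. D l \<subseteq> Poly_Mapping.keys a)" for a
  proof
    assume "\<exists>g\<in>G. \<exists>b. a = g + b"
    then show "\<exists>l\<in>L. D l \<subseteq> Poly_Mapping.keys a"
      using G by (fastforce simp: nonstandard_def keys_add_monomial)
  next
    assume "\<exists>l\<in>L. D l \<subseteq> Poly_Mapping.keys a"
    then show "\<exists>g\<in>G. \<exists>b. a = g + b"
      using D_in_G finite_D sqfree_mon_add_diff by metis
  qed
  moreover have "lead_ideal lt V ?I = Idl\<^bsub>poly_ring V\<^esub> (mon ` G)"
    by (simp add: lead_ideal_def G_def image_image)
  moreover have "Poly_Mapping.keys g \<subseteq> V" if "g \<in> G" for g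
    using G[OF that] by (simp add: nonstandard_def)
  ultimately show ?thesis by (simp add: Idl_monomials)
qed

end


section \<open>The graded reverse lexicographic order\<close>

lemma grevlex_monomial_order:
  fixes vlt :: "'v \<Rightarrow> 'v \<Rightarrow> bool"
  assumes irrefl: "\<And>v. \<not> vlt v v" and trans: "\<And>u v w. vlt u v \<Longrightarrow> vlt v w \<Longrightarrow> vlt u w"
    and total: "\<And>u v. u \<noteq> v \<Longrightarrow> vlt u v \<or> vlt v u"
  shows "monomial_order (grevlex vlt)"
proof
  fix a b c :: "'v monomial"
  show "\<not> grevlex vlt a a" by (simp add: grevlex_def)
  show "grevlex vlt (a + c) (b + c)" if "grevlex vlt a b"
    using that by (simp add: grevlex_def mdeg_add lookup_add)
  show "grevlex vlt a c" if ab: "grevlex vlt a b" and bc: "grevlex vlt b c"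
  proof (cases "mdeg a = mdeg b \<and> mdeg b = mdeg c")
    case True
    obtain v where v: "Poly_Mapping.lookup b v < Poly_Mapping.lookup a v"
      "\<And>w. vlt w v \<Longrightarrow> Poly_Mapping.lookup b w = Poly_Mapping.lookup a w"
      using ab True by (auto simp: grevlex_def)
    obtain v' where v': "Poly_Mapping.lookup c v' < Poly_Mapping.lookup b v'"
      "\<And>w. vlt w v' \<Longrightarrow> Poly_Mapping.lookup c w = Poly_Mapping.lookup b w"
      using bc True by (auto simp: grevlex_def)
    \<comment> \<open>The smaller of the two deciding variables decides the comparison of
      \<open>a\<close> with \<open>c\<close>.\<close>
    define x where "x = (if vlt v' v then v' else v)"
    have "Poly_Mapping.lookup c x < Poly_Mapping.lookup a x"
      using v v' total[of v v'] by (cases "v = v'") (auto simp: x_def)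
    moreover have "Poly_Mapping.lookup c w = Poly_Mapping.lookup a w" if "vlt w x" for w
    proof -
      have "vlt w v" "vlt w v'" using that total[of v v'] trans[of w v v'] trans[of w v' v]
        by (auto simp: x_def split: if_splits)
      then show ?thesis using v(2) v'(2) by simp
    qed
    ultimately show ?thesis using True unfolding grevlex_def by auto
  next
    case False
    then show ?thesis using ab bc by (auto simp: grevlex_def)
  qed
  show "grevlex vlt a b \<or> grevlex vlt b a" if "a \<noteq> b"
  proof -
    \<comment> \<open>Finite supports guarantee a smallest differing variable even when the variable
      type is infinite.\<close>
    define W where "W = {v. Poly_Mapping.lookup a v \<noteq> Poly_Mapping.lookup b v}"
    have "W \<subseteq> Poly_Mapping.keys a \<union> Poly_Mapping.keys b" by (auto simp: W_def in_keys_iff)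
    then have "finite W" by (rule finite_subset) simp
    moreover have "W \<noteq> {}" using that poly_mapping_eqI[of a b] unfolding W_def by blast
    moreover have "transp_on W vlt" by (rule transp_onI) (rule trans)
    moreover have "totalp_on W vlt" by (rule totalp_onI) (rule total)
    ultimately have "\<exists>v\<in>W. \<forall>w\<in>W. w \<noteq> v \<longrightarrow> vlt v w"
      by (rule Finite_Set.bex_least_element)
    then obtain v where v: "v \<in> W" "\<And>w. w \<in> W \<Longrightarrow> w \<noteq> v \<Longrightarrow> vlt v w" by blast
    have "Poly_Mapping.lookup a w = Poly_Mapping.lookup b w" if "vlt w v" for w
      using that v(2)[of w] irrefl[of v] trans[of v w v] by (auto simp: W_def)
    then show ?thesis using v(1) unfolding grevlex_def W_def
      by (metis (mono_tags, lifting) mem_Collect_eq nat_neq_iff)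
  qed
qed

lemma finite_grevlex_below:
  assumes "finite V"
  shows "finite {b. Poly_Mapping.keys b \<subseteq> V \<and> grevlex vlt b a}"
  by (rule finite_subset[OF _ finite_monomials_le[OF assms, of "mdeg a"]]) (auto simp: grevlex_def)


section \<open>Hilbert series of quotients by squarefree monomial ideals\<close>

definition face_ideal :: "'v set \<Rightarrow> ('l \<Rightarrow> 'v set) \<Rightarrow> 'l set \<Rightarrow> ('v, 'k::comm_ring_1) mpoly set" where
  "face_ideal V D L =
    {p \<in> carrier (poly_ring V). \<forall>a\<in>Poly_Mapping.keys p. \<exists>l\<in>L. D l \<subseteq> Poly_Mapping.keys a}"

lemma ideal_face_ideal: "ideal (face_ideal V D L :: ('v, 'k::comm_ring_1) mpoly set) (poly_ring V)"
proof (rule ideal_poly_ringI)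
  fix p q :: "('v, 'k) mpoly"
  assume "p \<in> face_ideal V D L" "q \<in> face_ideal V D L"
  then show "p + q \<in> face_ideal V D L"
    using keys_add[of p q] unfolding face_ideal_def by (blast intro: poly_ring_closed)
next
  fix p q :: "('v, 'k) mpoly"
  assume p: "p \<in> carrier (poly_ring V)" and q: "q \<in> face_ideal V D L"
  have "\<exists>l\<in>L. D l \<subseteq> Poly_Mapping.keys c" if c: "c \<in> Poly_Mapping.keys (p * q)" for c
    using c
  proof (rule keys_multE)
    fix a b assume "c = a + b" "b \<in> Poly_Mapping.keys q"
    then show ?thesis using q by (fastforce simp: face_ideal_def keys_add_monomial)
  qed
  then show "p * q \<in> face_ideal V D L"
    using p q by (simp add: face_ideal_def poly_ring_closed)
qed (auto simp: face_ideal_def intro: poly_ring_closed)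

lemma one_notin_face_ideal:
  assumes "\<And>l. l \<in> L \<Longrightarrow> D l \<noteq> {}"
  shows "1 \<notin> face_ideal V D L"
  using assms by (simp add: face_ideal_def)

lemma stanley_reisner_face_ideal:
  assumes "finite V"
  shows "stanley_reisner V (face_ideal V D L :: ('v, 'k::comm_ring_1) mpoly set) =
    {F. F \<subseteq> V \<and> (\<forall>l\<in>L. \<not> D l \<subseteq> F)}"
proof -
  have "(\<Prod>v\<in>F. X v :: ('v, 'k) mpoly) = Poly_Mapping.single (sqfree_mon F) 1" for F :: "'v set"
    by (induction F rule: infinite_finite_induct) (simp_all add: sqfree_mon_def X_def mon_def mult_single)
  then have "(\<Prod>v\<in>F. X v :: ('v, 'k) mpoly) \<in> face_ideal V D L \<longleftrightarrow> (\<exists>l\<in>L. D l \<subseteq> F)" if "F \<subseteq> V" for F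
    using that finite_subset[OF that assms] by (simp add: face_ideal_def in_poly_ring keys_sqfree_mon)
  then show ?thesis by (auto simp: stanley_reisner_def)
qed

text \<open>The classes of the avoiding monomials of degree \<open>d\<close> form a basis of the
  degree \<open>d\<close> component.\<close>

lemma hilbert_series_face_ideal:
  fixes V :: "'v set" and D :: "'l \<Rightarrow> 'v set" and L :: "'l set"
  assumes "finite V" and D_nonempty: "\<And>l. l \<in> L \<Longrightarrow> D l \<noteq> {}"
  shows "hilbert_series V (face_ideal V D L :: ('v, 'k::field) mpoly set) =
    mono_series (monomials_avoiding V D L)"
proof -
  let ?R = "poly_ring V :: ('v, 'k) mpoly ring"
  define J :: "('v, 'k) mpoly set" where "J = face_ideal V D L"
  let ?Q = "?R Quot J"
  let ?\<pi> = "\<lambda>p. J +>\<^bsub>?R\<^esub> p"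
  let ?K = "quot_field V J"
  interpret R: cring ?R by (rule cring_poly_ring)
  interpret J: ideal J ?R unfolding J_def by (rule ideal_face_ideal)
  interpret Q: cring ?Q by (rule J.quotient_is_cring[OF R.is_cring])
  interpret pi: ring_hom_ring ?R ?Q ?\<pi> by (rule J.rcos_ring_hom_ring)
  have pi_eq: "?\<pi> p = ?\<pi> q \<longleftrightarrow> p - q \<in> J" if "p \<in> carrier ?R" "q \<in> carrier ?R" for p q
    using R.quotient_eq_iff_same_a_r_cos[OF J.is_ideal that] poly_ring_a_minus[OF that] by simp
  have one_notin: "1 \<notin> J" unfolding J_def using D_nonempty by (rule one_notin_face_ideal)
  have Const_add: "Const (c + d) = (Const c + Const d :: ('v, 'k) mpoly)"
    and Const_mult: "Const (c * d) = (Const c * Const d :: ('v, 'k) mpoly)" for c d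
    by (simp_all add: Const_def single_add mult_single)
  have Const_one: "Const 1 = (1 :: ('v, 'k) mpoly)" by (simp add: Const_def)
  have Const_zero: "Const 0 = (0 :: ('v, 'k) mpoly)" by (simp add: Const_def)
  note C = poly_ring_Const_closed
  \<comment> \<open>Dimensions in the quotient are taken over a subfield of it. The constants form a
    subfield upstairs, and their image is one because the ideal is proper.\<close>
  have "subfield (range (Const :: 'k \<Rightarrow> ('v, 'k) mpoly)) ?R"
  proof (rule R.subfieldI)
    have "subring (range (Const :: 'k \<Rightarrow> ('v, 'k) mpoly)) ?R"
    proof (rule R.subringI)
      fix x assume "x \<in> range (Const :: 'k \<Rightarrow> ('v, 'k) mpoly)"
      then obtain c where c: "x = Const c" by blast
      have "Const (- c) + x = 0" unfolding c Const_add[symmetric] by (simp add: Const_zero)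
      then have "\<ominus>\<^bsub>?R\<^esub> x = Const (- c)"
        using C by (intro R.minus_equality) (simp_all add: c)
      then show "\<ominus>\<^bsub>?R\<^esub> x \<in> range Const" by simp
    next
      show "\<one>\<^bsub>?R\<^esub> \<in> range (Const :: 'k \<Rightarrow> ('v, 'k) mpoly)"
        using Const_one by (metis poly_ring_simps(2) rangeI)
    next
      fix x y assume "x \<in> range (Const :: 'k \<Rightarrow> ('v, 'k) mpoly)" "y \<in> range (Const :: 'k \<Rightarrow> ('v, 'k) mpoly)"
      then obtain c d where cd: "x = Const c" "y = Const d" by blast
      show "x \<otimes>\<^bsub>?R\<^esub> y \<in> range Const" using Const_mult[of c d] cd by (metis poly_ring_simps(1) rangeI)
      show "x \<oplus>\<^bsub>?R\<^esub> y \<in> range Const" using Const_add[of c d] cd by (metis poly_ring_simps(4) rangeI)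
    qed (use C in blast)
    then show "subcring (range (Const :: 'k \<Rightarrow> ('v, 'k) mpoly)) ?R"
      by (rule R.subcringI) (simp add: mult.commute)
    have "Const c \<in> Units (?R\<lparr>carrier := range Const\<rparr>)" if "c \<noteq> 0" for c :: 'k
    proof -
      have "Const (inverse c) * Const c = (1 :: ('v, 'k) mpoly)"
        using that by (simp add: Const_mult[symmetric] Const_one)
      then show ?thesis by (auto simp: Units_def mult.commute)
    qed
    moreover have "0 \<notin> Units (?R\<lparr>carrier := range Const\<rparr>)" by (auto simp: Units_def)
    ultimately show "Units (?R\<lparr>carrier := range Const\<rparr>) = range Const - {\<zero>\<^bsub>?R\<^esub>}"
      using Const_zero by (auto simp: Units_def) metis
  qed
  moreover have "\<one>\<^bsub>?Q\<^esub> \<noteq> \<zero>\<^bsub>?Q\<^esub>"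
  proof
    assume "\<one>\<^bsub>?Q\<^esub> = \<zero>\<^bsub>?Q\<^esub>"
    then have "?\<pi> 1 = ?\<pi> 0" using pi.hom_one pi.hom_zero by simp
    then show False using pi_eq[of 1 0] one_notin by (simp add: poly_ring_closed)
  qed
  ultimately have K: "subfield ?K ?Q"
    using pi.img_is_subfield(2)[of "range Const"] by (simp add: quot_field_def image_image)
  \<comment> \<open>The span of the classes of the monomials in \<open>A\<close>. Its dimension is
    computed by adjoining one monomial at a time, each a line extension.\<close>
  define E where "E A = ?\<pi> ` {p. Poly_Mapping.keys p \<subseteq> A}" for A :: "'v monomial set"
  have dim_E: "Q.dimension (card A) ?K (E A)"
    if "finite A" "A \<subseteq> monomials_avoiding V D L" for A
    using that
  proof (induction A)
    case empty
    have "E {} = {\<zero>\<^bsub>?Q\<^esub>}" using pi.hom_zero by (simp add: E_def)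
    then show ?case by simp
  next
    case (insert a A)
    have in_R: "p \<in> carrier ?R" if "Poly_Mapping.keys p \<subseteq> insert a A" for p
      using that insert.prems unfolding in_poly_ring monomials_avoiding_def by blast
    have mon_R: "mon a \<in> carrier ?R" by (rule in_R) (simp add: mon_def)
    \<comment> \<open>Independence: otherwise a polynomial of the ideal would contain the monomial
      \<open>a\<close>, whose support includes no block.\<close>
    have new: "?\<pi> (mon a) \<notin> E A"
    proof
      assume "?\<pi> (mon a) \<in> E A"
      then obtain p where p: "Poly_Mapping.keys p \<subseteq> A" "?\<pi> (mon a) = ?\<pi> p" by (auto simp: E_def)
      then have "mon a - p \<in> J" using pi_eq[OF mon_R in_R, of p] by auto
      moreover have "a \<notin> Poly_Mapping.keys p" using p(1) insert.hyps by blast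
      then have "a \<in> Poly_Mapping.keys (mon a - p)"
        by (simp add: in_keys_iff lookup_minus mon_def)
      ultimately obtain l where "l \<in> L" "D l \<subseteq> Poly_Mapping.keys a"
        unfolding J_def face_ideal_def by blast
      then show False using insert.prems unfolding monomials_avoiding_def by blast
    qed
    have pi_comb: "?\<pi> (Const c * mon a + p) =
        ?\<pi> (Const c) \<otimes>\<^bsub>?Q\<^esub> ?\<pi> (mon a) \<oplus>\<^bsub>?Q\<^esub> ?\<pi> p" if "Poly_Mapping.keys p \<subseteq> A" for c p
      using pi.hom_mult[OF C mon_R] pi.hom_add[OF R.m_closed[OF C mon_R] in_R[of p]] that by auto
    have "E (insert a A) = Q.line_extension ?K (?\<pi> (mon a)) (E A)"
    proof (intro equalityI subsetI)
      fix x assume "x \<in> E (insert a A)"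
      then obtain p where p: "Poly_Mapping.keys p \<subseteq> insert a A" "x = ?\<pi> p" by (auto simp: E_def)
      define c where "c = Poly_Mapping.lookup p a"
      define q where "q = p - Const c * mon a"
      have "Const c * mon a = Poly_Mapping.single a c" by (simp add: Const_def mon_def mult_single)
      then have q: "Poly_Mapping.keys q \<subseteq> A"
        using p(1) by (auto simp: q_def c_def in_keys_iff lookup_minus lookup_single when_def)
          (metis (full_types) in_keys_iff insertE subsetD)
      have "x = ?\<pi> (Const c * mon a + q)" by (simp add: p(2) q_def)
      then show "x \<in> Q.line_extension ?K (?\<pi> (mon a)) (E A)"
        unfolding Q.line_extension_mem_iff pi_comb[OF q] using q
        by (auto simp: quot_field_def E_def)
    next
      fix x assume "x \<in> Q.line_extension ?K (?\<pi> (mon a)) (E A)"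
      then obtain c p where p: "Poly_Mapping.keys p \<subseteq> A"
        "x = ?\<pi> (Const c) \<otimes>\<^bsub>?Q\<^esub> ?\<pi> (mon a) \<oplus>\<^bsub>?Q\<^esub> ?\<pi> p"
        unfolding Q.line_extension_mem_iff by (auto simp: quot_field_def E_def)
      have "Poly_Mapping.keys (Const c * mon a + p) \<subseteq> insert a A"
        using keys_add[of "Const c * mon a" p] p(1)
        by (auto simp: Const_def mon_def mult_single split: if_splits)
      then show "x \<in> E (insert a A)"
        unfolding E_def p(2) pi_comb[OF p(1), symmetric] by (intro imageI CollectI)
    qed
    moreover have "?\<pi> (mon a) \<in> carrier ?Q" using mon_R by (rule pi.hom_closed)
    ultimately show ?case
      using Q.Suc_dim[OF _ new] insert by simp
  qed
  have "Q.dim ?K (quot_component V J d) = card {a \<in> monomials_avoiding V D L. mdeg a = d}" for d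
  proof -
    let ?A = "{a \<in> monomials_avoiding V D L. mdeg a = d}"
    have "quot_component V J d = E ?A"
    proof (intro equalityI subsetI)
      fix x assume "x \<in> quot_component V J d"
      then obtain p where p: "p \<in> carrier ?R" "homogeneous d p" "x = ?\<pi> p"
        by (auto simp: quot_component_def)
      \<comment> \<open>The normal form of \<open>p\<close>: the discarded terms have supports
        containing a block, so they lie in the ideal.\<close>
      define q where "q = (\<Sum>a\<in>Poly_Mapping.keys p \<inter> ?A. Poly_Mapping.single a (Poly_Mapping.lookup p a))"
      have lookup_q: "Poly_Mapping.lookup q a = (if a \<in> ?A then Poly_Mapping.lookup p a else 0)" for a
        by (auto simp: q_def lookup_sum lookup_single when_def in_keys_iff)
      have q: "Poly_Mapping.keys q \<subseteq> ?A" by (auto simp: in_keys_iff lookup_q split: if_splits)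
      then have q_R: "q \<in> carrier ?R" by (auto simp: in_poly_ring monomials_avoiding_def)
      have "p - q \<in> J"
        unfolding J_def face_ideal_def
      proof (intro CollectI conjI ballI)
        show "p - q \<in> carrier ?R" using p(1) q_R by (rule poly_ring_closed)
        fix a assume "a \<in> Poly_Mapping.keys (p - q)"
        then have "a \<in> Poly_Mapping.keys p" "a \<notin> ?A"
          by (auto simp: in_keys_iff lookup_minus lookup_q split: if_splits)
        then show "\<exists>l\<in>L. D l \<subseteq> Poly_Mapping.keys a"
          using p by (auto simp: homogeneous_def in_poly_ring monomials_avoiding_def)
      qed
      then have "x = ?\<pi> q" using pi_eq[OF p(1) q_R] p(3) by simp
      then show "x \<in> E ?A" using q by (auto simp: E_def)
    next
      fix x assume "x \<in> E ?A"
      then show "x \<in> quot_component V J d"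
        by (fastforce simp: E_def quot_component_def homogeneous_def in_poly_ring monomials_avoiding_def)
    qed
    moreover have "Q.dimension (card ?A) ?K (E ?A)"
      using finite_monomials_avoiding_deg[OF \<open>finite V\<close>] by (intro dim_E) auto
    ultimately show ?thesis using Q.dimI[OF K] by (simp add: over_def)
  qed
  then show ?thesis by (simp add: hilbert_series_def mono_series_def J_def)
qed


section \<open>Leading monomials of the jets of the determinant\<close>

text \<open>
  The leading monomial of \<open>f\<^bsup>(l)\<^esup>\<close> takes from row \<open>i\<close> (counted from \<open>0\<close>) the entry in column
  \<open>lead_col m l i\<close> (counted from \<open>0\<close>) with upper index \<open>lead_idx m l i\<close>: for \<open>l = q * m + r\<close> the
  first \<open>m - r\<close> rows have upper index \<open>q\<close> and the last \<open>r\<close> rows \<open>q + 1\<close>, along antidiagonals.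
\<close>

definition lead_col :: "nat \<Rightarrow> nat \<Rightarrow> nat \<Rightarrow> nat" where
  "lead_col m l i = (if i < m then m - 1 - (l + i) mod m else i)"

text \<open>\<open>restrict\<close> puts the choice into the \<open>PiE\<close> set of the
  determinant expansion, just as \<open>lead_col\<close> is the identity outside the rows in order
  to be a permutation.\<close>

definition lead_idx :: "nat \<Rightarrow> nat \<Rightarrow> nat \<Rightarrow> nat" where
  "lead_idx m l = restrict (\<lambda>i. (l + i) div m) {0..<m}"

definition jet_monomial :: "nat \<Rightarrow> (nat \<Rightarrow> nat) \<Rightarrow> (nat \<Rightarrow> nat) \<Rightarrow> jvar monomial" where
  "jet_monomial m \<sigma> g = (\<Sum>i\<in>{0..<m}. Poly_Mapping.single (Suc i, Suc (\<sigma> i), g i) 1)"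

definition jet_block :: "nat \<Rightarrow> nat \<Rightarrow> jvar set" where
  "jet_block m l = (\<lambda>i. (Suc i, Suc (lead_col m l i), lead_idx m l i)) ` {0..<m}"

lemma lookup_jet_monomial:
  "Poly_Mapping.lookup (jet_monomial m \<sigma> g) v =
    (if \<exists>i<m. v = (Suc i, Suc (\<sigma> i), g i) then 1 else 0)"
proof (cases "\<exists>i<m. v = (Suc i, Suc (\<sigma> i), g i)")
  case True
  then obtain i where i: "i < m" "v = (Suc i, Suc (\<sigma> i), g i)" by blast
  have "Poly_Mapping.lookup (jet_monomial m \<sigma> g) v = (\<Sum>j\<in>{0..<m}. if j = i then 1 else 0)"
    unfolding jet_monomial_def lookup_sum
    by (intro sum.cong) (auto simp: i(2) lookup_single when_def)
  then show ?thesis using True i(1) by simp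
next
  case False
  then show ?thesis
    by (auto simp: jet_monomial_def lookup_sum lookup_single when_def intro!: sum.neutral)
qed

lemma mdeg_jet_monomial: "mdeg (jet_monomial m \<sigma> g) = m"
  by (simp add: jet_monomial_def mdeg_sum)

lemma jet_monomial_lead:
  "jet_monomial m (lead_col m l) (lead_idx m l) = sqfree_mon (jet_block m l)"
  unfolding jet_monomial_def sqfree_mon_def jet_block_def
  by (subst sum.reindex) (auto simp: inj_on_def)

text \<open>Each variable names its row, so the choices can be read off. Hence no two terms of the
  expansion share a monomial, and the leading one cannot cancel.\<close>

lemma jet_monomial_inject:
  assumes "\<sigma> permutes {0..<m}" "\<tau> permutes {0..<m}"
    and "g \<in> extensional {0..<m}" "h \<in> extensional {0..<m}"
    and eq: "jet_monomial m \<sigma> g = jet_monomial m \<tau> h"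
  shows "\<sigma> = \<tau>" "g = h"
proof -
  have *: "\<sigma> i = \<tau> i \<and> g i = h i" if "i < m" for i
  proof -
    have "Poly_Mapping.lookup (jet_monomial m \<tau> h) (Suc i, Suc (\<sigma> i), g i) = 1"
      unfolding eq[symmetric] lookup_jet_monomial using that by auto
    then show ?thesis by (auto simp: lookup_jet_monomial split: if_splits)
  qed
  show "\<sigma> = \<tau>" using * assms(1,2) by (intro ext) (metis atLeastLessThan_iff permutes_not_in zero_le)
  show "g = h" using * assms(3,4) by (intro extensionalityI) auto
qed

text \<open>Hermite's identity. Passing from \<open>l\<close> to \<open>l + 1\<close> shifts the
  window of summation: \<open>l div m\<close> leaves and \<open>(l + m) div m\<close>, larger by
  one, enters.\<close>

lemma sum_add_div:
  assumes "0 < m"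
  shows "(\<Sum>i<m. (l + i) div m) = (l :: nat)"
proof (induction l)
  case 0
  then show ?case by (intro sum.neutral) auto
next
  case (Suc l)
  have "l div m + (\<Sum>i<m. (Suc l + i) div m) = (\<Sum>i<Suc m. (l + i) div m)"
    by (subst sum.lessThan_Suc_shift) simp
  also have "\<dots> = l + (l + m) div m" using Suc by simp
  finally show ?case using assms by simp
qed

lemma sum_lead_idx: "0 < m \<Longrightarrow> (\<Sum>i\<in>{0..<m}. lead_idx m l i) = l"
  by (subst sum_add_div[symmetric, of m l]) (auto simp: lead_idx_def intro: sum.cong)

text \<open>The \<open>m\<close> consecutive numbers \<open>l + i\<close> have distinct residues
  modulo \<open>m\<close>.\<close>

lemma lead_col_permutes: "lead_col m l permutes {0..<m}"
proof (rule bij_imp_permutes)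
  have "inj_on (lead_col m l) {0..<m}"
  proof (rule inj_onI)
    fix i j assume ij: "i \<in> {0..<m}" "j \<in> {0..<m}" "lead_col m l i = lead_col m l j"
    then have "(l + i) mod m < m" "(l + j) mod m < m" by auto
    moreover have "m - 1 - (l + i) mod m = m - 1 - (l + j) mod m" using ij by (simp add: lead_col_def)
    ultimately have "(l + i) mod m = (l + j) mod m" by linarith
    moreover have *: "y = x" if "x \<le> y" "y < m" "(l + y) mod m = (l + x) mod m" for x y
    proof -
      have "m dvd y - x" using that mod_eq_dvd_iff_nat[of "l + x" "l + y" m] by simp
      then have "\<not> 0 < y - x" using that dvd_imp_le[of m "y - x"] by linarith
      then show ?thesis using that by simp
    qed
    ultimately show "i = j" using ij *[of i j] *[of j i] by (cases "i \<le> j") auto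
  qed
  moreover have "lead_col m l ` {0..<m} \<subseteq> {0..<m}" by (auto simp: lead_col_def)
  ultimately show "bij_betw (lead_col m l) {0..<m} {0..<m}"
    by (simp add: bij_betw_def endo_inj_surj)
qed (simp add: lead_col_def)

text \<open>
  At the smallest variable \<open>v\<close>, lying in row \<open>i\<close>, that divides the leading monomial but not its
  competitor, every row of the competitor already has at least the upper index of the leading
  monomial, and row \<open>i\<close> a larger one; but both sums of upper indices are \<open>l\<close>.
\<close>

lemma jet_monomial_less_lead:
  assumes \<sigma>: "\<sigma> permutes {0..<m}" and g: "(\<Sum>i\<in>{0..<m}. g i) = l"
    and less: "Poly_Mapping.lookup (jet_monomial m \<sigma> g) v <
      Poly_Mapping.lookup (jet_monomial m (lead_col m l) (lead_idx m l)) v"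
    and agree: "\<And>w. jvar_less w v \<Longrightarrow> Poly_Mapping.lookup (jet_monomial m \<sigma> g) w =
      Poly_Mapping.lookup (jet_monomial m (lead_col m l) (lead_idx m l)) w"
  shows False
proof -
  let ?c = "lead_col m l" and ?b = "lead_idx m l"
  obtain i where i: "i < m" "v = (Suc i, Suc (?c i), ?b i)"
    using less by (auto simp: lookup_jet_monomial split: if_splits)
  have b: "?b r = (l + r) div m" if "r < m" for r using that by (simp add: lead_idx_def)
  have ne: "\<not> (\<sigma> i = ?c i \<and> g i = ?b i)"
    using less i by (auto simp: lookup_jet_monomial split: if_splits)
  \<comment> \<open>A variable below \<open>v\<close> that divides one monomial divides the other,
    and since it names its row, the two choices in that row coincide.\<close>
  have below1: "\<sigma> r = ?c r \<and> g r = ?b r" if "r < m" "jvar_less (Suc r, Suc (\<sigma> r), g r) v" for r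
    using agree[OF that(2)] that(1) by (auto simp: lookup_jet_monomial split: if_splits)
  have below2: "\<sigma> r = ?c r \<and> g r = ?b r" if "r < m" "jvar_less (Suc r, Suc (?c r), ?b r) v" for r
    using agree[OF that(2)] that(1) by (auto simp: lookup_jet_monomial split: if_splits)
  have le: "?b r \<le> g r" if r: "r < m" "r \<noteq> i" for r
  proof (cases "\<sigma> r = ?c r \<and> g r = ?b r")
    case False
    then have "\<not> jvar_less (Suc r, Suc (\<sigma> r), g r) v" using below1 r by blast
    then have *: "?b i < g r \<or> ?b i = g r \<and> r < i"
      using i r by (auto simp: jvar_less_def)
    show ?thesis
    proof (cases "r < i")
      case True
      then have "?b r \<le> ?b i" using i r b by (simp add: div_le_mono)
      then show ?thesis using * by auto
    next
      case False
      then have "?b i < g r" using * by auto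
      \<comment> \<open>The leading indices exceed each other by at most one.\<close>
      moreover have "?b r \<le> (l + i + m) div m" using div_le_mono[of "l + r" "l + i + m" m] r b by simp
      moreover have "(l + i + m) div m = Suc (?b i)" using div_add_self2[of m "l + i"] i(1) b by simp
      ultimately show ?thesis by linarith
    qed
  qed simp
  have lt: "?b i < g i"
  proof (rule ccontr)
    assume "\<not> ?b i < g i"
    moreover have "\<not> jvar_less (Suc i, Suc (\<sigma> i), g i) v" using below1 i(1) ne by blast
    ultimately have gt: "\<sigma> i < ?c i" using i ne by (auto simp: jvar_less_def)
    have "\<sigma> i < m" using \<sigma> i(1) by (metis atLeastLessThan_iff permutes_in_image zero_le)
    \<comment> \<open>The row where the leading monomial uses column \<open>\<sigma> i\<close>. Its
      variable turns out to be below \<open>v\<close>, so the competitor shares it and would use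
      that column twice.\<close>
    then obtain r where r: "r < m" "?c r = \<sigma> i"
      using permutes_surj[OF lead_col_permutes, of m l] permutes_in_image[OF lead_col_permutes, of m l]
      by (metis atLeastLessThan_iff surjD zero_le)
    have "0 < m" using i(1) by simp
    then have "(l + r) mod m < m" "(l + i) mod m < m" by auto
    then have mod_less: "(l + i) mod m < (l + r) mod m"
      using gt r i(1) by (auto simp: lead_col_def)
    have decomp: "?b r * m + (l + r) mod m = l + r" "?b i * m + (l + i) mod m = l + i"
      using b r(1) i(1) by simp_all
    have "\<not> ?b i < ?b r"
    proof
      assume "?b i < ?b r"
      then have "Suc (?b i) * m \<le> ?b r * m" by (intro mult_le_mono1) simp
      then show False using decomp mod_less r(1) by simp
    qed
    moreover have "i < r" if "?b r = ?b i" using decomp mod_less that by simp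
    ultimately have "jvar_less (Suc r, Suc (?c r), ?b r) v"
      using i by (auto simp: jvar_less_def)
    then have "\<sigma> r = \<sigma> i" using below2[OF r(1)] r(2) by simp
    then have "r = i" using permutes_inj[OF \<sigma>] by (auto dest: injD)
    then show False using r(2) gt by simp
  qed
  have "(\<Sum>r\<in>{0..<m}. ?b r) < (\<Sum>r\<in>{0..<m}. g r)"
  proof (rule sum_strict_mono_ex1)
    show "\<forall>r\<in>{0..<m}. ?b r \<le> g r" using le lt by (metis atLeastLessThan_iff less_imp_le)
    show "\<exists>r\<in>{0..<m}. ?b r < g r" using lt i(1) by auto
  qed simp
  then show False using g sum_lead_idx[of m l] i(1) by simp
qed

lemma jvar_monomial_order: "monomial_order (grevlex jvar_less)"
  by (rule grevlex_monomial_order) (auto simp: jvar_less_def)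

lemma jet_monomial_grevlex_lead:
  assumes "\<sigma> permutes {0..<m}" "(\<Sum>i\<in>{0..<m}. g i) = l"
    and ne: "jet_monomial m \<sigma> g \<noteq> sqfree_mon (jet_block m l)"
  shows "grevlex jvar_less (jet_monomial m \<sigma> g) (sqfree_mon (jet_block m l))"
proof -
  have "\<not> grevlex jvar_less (sqfree_mon (jet_block m l)) (jet_monomial m \<sigma> g)"
    unfolding grevlex_def jet_monomial_lead[symmetric] mdeg_jet_monomial
    using jet_monomial_less_lead[OF assms(1,2)] by blast
  then show ?thesis using monomial_order.total[OF jvar_monomial_order] ne by blast
qed

lemma jet_det_expansion:
  "jet_det m k l = (\<Sum>\<sigma> | \<sigma> permutes {0..<m}. \<Sum>g | g \<in> PiE {0..<m} (\<lambda>_. {0..k}) \<and> (\<Sum>i\<in>{0..<m}. g i) = l.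
    Poly_Mapping.single (jet_monomial m \<sigma> g) (signof \<sigma> :: 'k::comm_ring_1))"
proof -
  let ?P = "PiE {0..<m} (\<lambda>_. {0..k})"
  have fin: "finite ?P" by (intro finite_PiE) auto
  have entries: "(\<Prod>i\<in>{0..<m}. jet_matrix m k $$ (i, \<sigma> i)) =
      (\<Sum>g\<in>?P. Polynomial.monom (Poly_Mapping.single (jet_monomial m \<sigma> g) 1) (\<Sum>i\<in>{0..<m}. g i)
        :: (jvar, 'k) mpoly poly)"
    if \<sigma>: "\<sigma> permutes {0..<m}" for \<sigma>
  proof -
    have monom_prod: "(\<Prod>i\<in>A. Polynomial.monom (X (Suc i, Suc (\<sigma> i), g i) :: (jvar, 'k) mpoly) (g i)) =
        Polynomial.monom (Poly_Mapping.single (\<Sum>i\<in>A. Poly_Mapping.single (Suc i, Suc (\<sigma> i), g i) 1) 1)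
          (\<Sum>i\<in>A. g i)" if "finite A" for A and g :: "nat \<Rightarrow> nat"
      using that by induction (simp_all add: mult_monom X_def mon_def mult_single)
    have "jet_matrix m k $$ (i, \<sigma> i) =
        (\<Sum>b\<in>{0..k}. Polynomial.monom (X (Suc i, Suc (\<sigma> i), b) :: (jvar, 'k) mpoly) b)"
      if "i \<in> {0..<m}" for i
    proof -
      have "\<sigma> i < m" using permutes_in_image[OF \<sigma>, of i] that by simp
      then show ?thesis using that by (simp add: jet_matrix_def)
    qed
    then have "(\<Prod>i\<in>{0..<m}. jet_matrix m k $$ (i, \<sigma> i)) =
        (\<Prod>i\<in>{0..<m}. \<Sum>b\<in>{0..k}. Polynomial.monom (X (Suc i, Suc (\<sigma> i), b) :: (jvar, 'k) mpoly) b)"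
      by (intro prod.cong) auto
    also have "\<dots> = (\<Sum>g\<in>?P. \<Prod>i\<in>{0..<m}. Polynomial.monom (X (Suc i, Suc (\<sigma> i), g i)) (g i))"
      by (rule prod_sum_PiE) auto
    also have "\<dots> = (\<Sum>g\<in>?P. Polynomial.monom (Poly_Mapping.single (jet_monomial m \<sigma> g) 1) (\<Sum>i\<in>{0..<m}. g i))"
      by (simp add: monom_prod jet_monomial_def)
    finally show ?thesis .
  qed
  \<comment> \<open>The sign is first taken in the polynomials in \<open>t\<close>; this fact and
    the next move it to the multivariate polynomials and then to the coefficients.\<close>
  have signof: "Polynomial.coeff (signof \<sigma> * p) l = signof \<sigma> * Polynomial.coeff p l"
    for \<sigma> and p :: "(jvar, 'k) mpoly poly" by (simp add: sign_def)
  have signof': "signof \<sigma> * Poly_Mapping.single a 1 = Poly_Mapping.single a (signof \<sigma> :: 'k)"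
    for \<sigma> and a :: "jvar monomial" by (simp add: sign_def single_uminus)
  have carrier: "jet_matrix m k \<in> carrier_mat m m" by (simp add: jet_matrix_def)
  have "jet_det m k l = (\<Sum>\<sigma> | \<sigma> permutes {0..<m}. signof \<sigma> *
      Polynomial.coeff (\<Prod>i\<in>{0..<m}. jet_matrix m k $$ (i, \<sigma> i) :: (jvar, 'k) mpoly poly) l)"
    unfolding jet_det_def det_def'[OF carrier]
    by (simp add: coeff_sum signof)
  also have "\<dots> = (\<Sum>\<sigma> | \<sigma> permutes {0..<m}. \<Sum>g\<in>?P. if (\<Sum>i\<in>{0..<m}. g i) = l
      then Poly_Mapping.single (jet_monomial m \<sigma> g) (signof \<sigma>) else 0)"
    by (intro sum.cong refl)
      (simp add: entries coeff_sum sum_distrib_left coeff_monom signof' if_distrib cong: if_cong)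
  also have "\<dots> = (\<Sum>\<sigma> | \<sigma> permutes {0..<m}. \<Sum>g | g \<in> ?P \<and> (\<Sum>i\<in>{0..<m}. g i) = l.
      Poly_Mapping.single (jet_monomial m \<sigma> g) (signof \<sigma>))"
    using fin by (simp add: sum.If_cases Int_def)
  finally show ?thesis .
qed

lemma jet_det_closed: "jet_det m k l \<in> carrier (poly_ring (jet_vars m k))"
  unfolding jet_det_expansion
proof (intro poly_ring_sum_closed poly_ring_single_closed subsetI)
  fix \<sigma> g and v :: jvar
  assume *: "\<sigma> \<in> {\<sigma>. \<sigma> permutes {0..<m}}" "g \<in> {g \<in> PiE {0..<m} (\<lambda>_. {0..k}). (\<Sum>i\<in>{0..<m}. g i) = l}"
    and "v \<in> Poly_Mapping.keys (jet_monomial m \<sigma> g)"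
  then obtain i where "i < m" "v = (Suc i, Suc (\<sigma> i), g i)"
    by (auto simp: in_keys_iff lookup_jet_monomial split: if_splits)
  then show "v \<in> jet_vars m k"
    using * permutes_in_image[of \<sigma> "{0..<m}" i] by (auto simp: jet_vars_def PiE_iff Suc_le_eq)
qed

lemma jet_det_leading:
  assumes "0 < m" "l \<le> k"
  shows "leading (grevlex jvar_less) (jet_det m k l) (sqfree_mon (jet_block m l))
    (signof (lead_col m l) :: 'k::comm_ring_1)"
proof -
  interpret monomial_order "grevlex jvar_less" by (rule jvar_monomial_order)
  define T where "T = {\<sigma>. \<sigma> permutes {0..<m}} \<times>
    {g \<in> PiE {0..<m} (\<lambda>_. {0..k}). (\<Sum>i\<in>{0..<m}. g i) = l}"
  define t where "t = (\<lambda>(\<sigma>, g). Poly_Mapping.single (jet_monomial m \<sigma> g) (signof \<sigma> :: 'k))"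
  let ?x = "(lead_col m l, lead_idx m l)"
  have "finite (PiE {0..<m} (\<lambda>_. {0..k}))" by (intro finite_PiE) auto
  then have "finite T"
    unfolding T_def by (intro finite_cartesian_product finite_permutations) auto
  \<comment> \<open>Here \<open>l \<le> k\<close> matters: truncating the jets at \<open>k\<close>
    does not cut off the leading term.\<close>
  have "lead_idx m l i \<le> k" if "i < m" for i
  proof -
    have "lead_idx m l i \<le> (\<Sum>i\<in>{0..<m}. lead_idx m l i)" using that by (intro member_le_sum) auto
    then show ?thesis using sum_lead_idx[OF assms(1)] assms(2) by simp
  qed
  then have x: "?x \<in> T"
    using lead_col_permutes sum_lead_idx[OF assms(1)] by (auto simp: T_def lead_idx_def)
  have "jet_det m k l = (\<Sum>x\<in>T. t x)"
    unfolding jet_det_expansion T_def t_def by (rule sum.cartesian_product)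
  also have "\<dots> = t ?x + (\<Sum>x\<in>T - {?x}. t x)" using \<open>finite T\<close> x by (rule sum.remove)
  finally have eq: "jet_det m k l = t ?x + (\<Sum>x\<in>T - {?x}. t x)" .
  show ?thesis
    unfolding eq
  proof (rule leading_add_lower)
    show "leading (grevlex jvar_less) (t ?x) (sqfree_mon (jet_block m l)) (signof (lead_col m l))"
      by (simp add: t_def jet_monomial_lead leading_single)
    fix b assume "b \<in> Poly_Mapping.keys (\<Sum>x\<in>T - {?x}. t x)"
    then obtain \<sigma> g where y: "(\<sigma>, g) \<in> T" "(\<sigma>, g) \<noteq> ?x" "b = jet_monomial m \<sigma> g"
      using keys_sum_subset[of t "T - {?x}"] by (fastforce simp: t_def split: if_splits)
    have "jet_monomial m \<sigma> g \<noteq> sqfree_mon (jet_block m l)"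
      using y(1,2) jet_monomial_inject[OF _ lead_col_permutes, of \<sigma> m g "lead_idx m l"]
      unfolding jet_monomial_lead[symmetric] by (auto simp: T_def PiE_iff lead_idx_def)
    then show "grevlex jvar_less b (sqfree_mon (jet_block m l))"
      using y by (auto simp: T_def intro: jet_monomial_grevlex_lead)
  qed
qed

section \<open>The supports of the leading monomials\<close>

lemma card_jet_block: "card (jet_block m l) = m"
  unfolding jet_block_def by (subst card_image) (auto simp: inj_on_def)

lemma jet_block_subset:
  assumes "l \<le> k"
  shows "jet_block m l \<subseteq> jet_vars m k"
proof
  fix v assume "v \<in> jet_block m l"
  then obtain i where i: "i < m" "v = (Suc i, Suc (lead_col m l i), lead_idx m l i)"
    by (auto simp: jet_block_def)
  have "lead_idx m l i \<le> (\<Sum>i\<in>{0..<m}. lead_idx m l i)" using i(1) by (intro member_le_sum) auto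
  then have "lead_idx m l i \<le> k" using sum_lead_idx[of m l] i(1) assms by simp
  then show "v \<in> jet_vars m k"
    using i permutes_in_image[OF lead_col_permutes, of m l i] by (auto simp: jet_vars_def Suc_le_eq)
qed

text \<open>A variable of the block records \<open>i\<close> together with quotient and remainder of
  \<open>l + i\<close> by \<open>m\<close>, and so determines \<open>l\<close>.\<close>

lemma disjoint_jet_block: "disjoint_family_on (jet_block m) L"
  unfolding disjoint_family_on_def
proof (intro ballI impI)
  fix l l' :: nat assume "l \<noteq> l'"
  have False if i: "i < m" "lead_col m l i = lead_col m l' i" "lead_idx m l i = lead_idx m l' i" for i
  proof -
    have "0 < m" using i(1) by simp
    then have "(l + i) mod m < m" "(l' + i) mod m < m" by auto
    moreover have "m - 1 - (l + i) mod m = m - 1 - (l' + i) mod m" using i by (simp add: lead_col_def)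
    ultimately have "(l + i) mod m = (l' + i) mod m" by linarith
    moreover have "(l + i) div m = (l' + i) div m" using i by (simp add: lead_idx_def)
    ultimately have "l + i = l' + i" by (metis div_mult_mod_eq)
    then show False using \<open>l \<noteq> l'\<close> by simp
  qed
  then show "jet_block m l \<inter> jet_block m l' = {}" by (auto simp: jet_block_def)
qed

lemma finite_jet_vars: "finite (jet_vars m k)" by (simp add: jet_vars_def)

lemma card_jet_vars: "card (jet_vars m k) = m\<^sup>2 * (k + 1)"
  by (simp add: jet_vars_def card_cartesian_product power2_eq_square algebra_simps)

lemma jet_lead_ideal_eq:
  assumes "0 < m"
  shows "jet_lead_ideal m k = (face_ideal (jet_vars m k) (jet_block m) {0..k} :: (jvar, 'k::field) mpoly set)"
proof -
  have "coprime_leading (grevlex jvar_less) (jet_vars m k) {0..k} (jet_block m)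
    (jet_det m k :: nat \<Rightarrow> (jvar, 'k) mpoly) (\<lambda>l. signof (lead_col m l))"
  proof (intro coprime_leading.intro jvar_monomial_order coprime_leading_axioms.intro)
    show "jet_block m l \<noteq> {}" for l using card_jet_block[of m l] assms by auto
    show "signof (lead_col m l) \<noteq> (0 :: 'k)" for l by (simp add: sign_def)
  qed (use assms in \<open>auto simp: finite_jet_vars finite_grevlex_below disjoint_jet_block jet_det_closed
      jet_det_leading dest: jet_block_subset[THEN subsetD, rotated]\<close>)
  from coprime_leading.lead_ideal_eq[OF this] show ?thesis
    by (simp add: jet_lead_ideal_def jet_ideal_def face_ideal_def)
qed

theorem theorem1:
  fixes m k :: nat
    and J :: "(jvar, 'k::alg_closed_field) mpoly set"
  assumes "m \<ge> 1"
    and "J = jet_lead_ideal m k"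
  shows "shellable (stanley_reisner (jet_vars m k) J) \<and>
         hilbert_series (jet_vars m k) J =
           (1 - fps_X ^ m) ^ (k + 1) / (1 - fps_X) ^ (m\<^sup>2 * (k + 1))"
proof
  let ?V = "jet_vars m k" and ?D = "jet_block m" and ?L = "{0..k}"
  have J: "J = face_ideal ?V ?D ?L" using assms jet_lead_ideal_eq[of m k] by simp
  show "shellable (stanley_reisner ?V J)"
    unfolding J stanley_reisner_face_ideal[OF finite_jet_vars]
    using jet_block_subset by (intro shellable_avoiding finite_jet_vars disjoint_jet_block) auto
  have "?D l \<noteq> {}" for l using card_jet_block[of m l] assms(1) by auto
  then have "hilbert_series ?V J = mono_series (monomials_avoiding ?V ?D ?L)"
    unfolding J by (intro hilbert_series_face_ideal finite_jet_vars)
  also have "\<dots> = (\<Prod>l\<in>?L. 1 - fps_X ^ card (?D l)) * mono_series (monomials_avoiding ?V ?D {})"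
    using jet_block_subset by (intro mono_series_monomials_avoiding finite_jet_vars disjoint_jet_block) auto
  also have "mono_series (monomials_avoiding ?V ?D {}) = inverse ((1 - fps_X) ^ (m\<^sup>2 * (k + 1)))"
    using mono_series_all_monomials[OF finite_jet_vars, of m k ?D]
    by (intro fps_inverse_unique[symmetric]) (simp add: card_jet_vars mult.commute)
  \<comment> \<open>The denominator has constant term 1, so division is multiplication by the
    inverse.\<close>
  finally show "hilbert_series ?V J = (1 - fps_X ^ m) ^ (k + 1) / (1 - fps_X) ^ (m\<^sup>2 * (k + 1))"
    by (simp add: card_jet_block fps_divide_unit)
qed

end
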